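(* Let $M$ be a rank-$r$ matroid on $n$ elements. For $0\le h\le k\le r$ and every sequence $(s_h,s_{h+1},\ldots,s_k)$ of nonnegative integers, the number $F_{h,k}(s_h,s_{h+1},\ldots,s_k)$, and in particular the number $f_k(s)$ of flats of $M$ of rank $k$ and size $s$, is derivable from the catenary data of $M$ (that is, these numbers agree for any two rank-$r$ matroids on $n$ elements having the same catenary data). Also, if $f_k(s)=1$ and $F$ is the unique flat of $M$ of rank $k$ and size $s$, then both $\mathcal{G}(M|F)$ and $\mathcal{G}(M/F)$ can be derived from $\mathcal{G}(M)$ (that is, if $M_1$ is another matroid with $\mathcal{G}(M_1)=\mathcal{G}(M)$, then $M_1$ has a unique flat $F_1$ of rank $k$ and size $s$, and $\mathcal{G}(M_1|F_1)=\mathcal{G}(M|F)$ and $\mathcal{G}(M_1/F_1)=\mathcal{G}(M/F)$).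
   Context: For a rank-$r$ matroid $M$ on an $n$-element set $E$: $F_{h,k}(s_h,\ldots,s_k)$ is the number of chains $X_h\subset X_{h+1}\subset\cdots\subset X_k$ of flats of $M$ with $r(X_j)=j$ and $|X_j|=s_j$ for $h\le j\le k$; when $h=k$, $F_{k,k}(s)=f_k(s)$, the number of flats of rank $k$ and size $s$. An $(n,r)$-composition is an integer sequence $(a_0,\ldots,a_r)$ with $a_0\ge0$, $a_j>0$ for $1\le j\le r$, and sum $n$. A flag is a chain $X_0\subset X_1\subset\cdots\subset X_r=E$ of flats with $r(X_j)=j$; its composition is $(|X_0|,|X_1-X_0|,\ldots,|X_r-X_{r-1}|)$. $\nu(M;a_0,\ldots,a_r)$ is the number of flags with composition $(a_0,\ldots,a_r)$; the catenary data of $M$ is the vector of these numbers indexed by $(n,r)$-compositions. $\mathcal{G}(n,r)$ is the vector space over a field of characteristic zero with basis the formal symbols $[\underline{r}]$, one for each $0,1$-sequence of length $n$ with exactly $r$ ones. For a permutation (linear ordering) $\pi$ of $E$, the rank sequence $\underline{r}(\pi)=r_1\ldots r_n$ has $r_j=r(\{\pi(1),\ldots,\pi(j)\})-r(\{\pi(1),\ldots,\pi(j-1)\})$, and $\mathcal{G}(M)=\sum_\pi[\underline{r}(\pi)]\in\mathcal{G}(n,r)$ over all $n!$ permutations of $E$. Two matroids have the same $\mathcal{G}$-invariant if and only if they have the same catenary data. $M|F$ and $M/F$ denote restriction to and contraction by $F$. *)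

theory Defs
  imports "HOL-Library.Poly_Mapping" "HOL-Combinatorics.Multiset_Permutations"
begin

text \<open>
  A matroid is given by its ground set and its rank function. Only the values \<open>rk M X\<close> with
  \<open>X \<subseteq> ground M\<close> are meaningful; nothing below depends on the other values.
\<close>

record 'a ranked_set =
  ground :: "'a set"
  rk :: "'a set \<Rightarrow> nat"

locale matroid =
  fixes M :: "'a ranked_set"
  assumes finite_ground: "finite (ground M)"
    and rk_le_card: "X \<subseteq> ground M \<Longrightarrow> rk M X \<le> card X"
    and rk_mono: "X \<subseteq> Y \<Longrightarrow> Y \<subseteq> ground M \<Longrightarrow> rk M X \<le> rk M Y"
    and rk_submodular: "X \<subseteq> ground M \<Longrightarrow> Y \<subseteq> ground M \<Longrightarrow>
      rk M (X \<union> Y) + rk M (X \<inter> Y) \<le> rk M X + rk M Y"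

definition rank_of :: "'a ranked_set \<Rightarrow> nat" where
  "rank_of M = rk M (ground M)"

definition restriction :: "'a ranked_set \<Rightarrow> 'a set \<Rightarrow> 'a ranked_set" where
  "restriction M F = \<lparr>ground = F, rk = rk M\<rparr>"

definition contraction :: "'a ranked_set \<Rightarrow> 'a set \<Rightarrow> 'a ranked_set" where
  "contraction M F = \<lparr>ground = ground M - F, rk = (\<lambda>X. rk M (X \<union> F) - rk M F)\<rparr>"

definition flat :: "'a ranked_set \<Rightarrow> 'a set \<Rightarrow> bool" where
  "flat M F \<longleftrightarrow> F \<subseteq> ground M \<and> (\<forall>x \<in> ground M - F. rk M F < rk M (insert x F))"

definition flats_rank_size :: "'a ranked_set \<Rightarrow> nat \<Rightarrow> nat \<Rightarrow> 'a set set" where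
  "flats_rank_size M k s = {F. flat M F \<and> rk M F = k \<and> card F = s}"

definition f_num :: "'a ranked_set \<Rightarrow> nat \<Rightarrow> nat \<Rightarrow> nat" where
  "f_num M k s = card (flats_rank_size M k s)"

text \<open>
  A chain \<open>X\<^sub>h \<subset> \<dots> \<subset> X\<^sub>k\<close> of flats with \<open>r(X\<^sub>j) = j\<close> is the list \<open>[X\<^sub>h, \<dots>, X\<^sub>k]\<close>,
  so the entry at position \<open>i\<close> has rank \<open>h + i\<close>.
\<close>

definition flat_chains :: "'a ranked_set \<Rightarrow> nat \<Rightarrow> nat \<Rightarrow> 'a set list set" where
  "flat_chains M h k = {Xs. length Xs = k - h + 1 \<and> sorted_wrt (\<subset>) Xs \<and>
     (\<forall>i < length Xs. flat M (Xs ! i) \<and> rk M (Xs ! i) = h + i)}"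

definition F_num :: "'a ranked_set \<Rightarrow> nat \<Rightarrow> nat \<Rightarrow> nat list \<Rightarrow> nat" where
  "F_num M h k s = card {Xs \<in> flat_chains M h k. map card Xs = s}"

definition compositions :: "nat \<Rightarrow> nat \<Rightarrow> nat list set" where
  "compositions n r = {a. length a = r + 1 \<and> (\<forall>j \<in> {1..r}. a ! j > 0) \<and> sum_list a = n}"

definition flags :: "'a ranked_set \<Rightarrow> 'a set list set" where
  "flags M = {Xs \<in> flat_chains M 0 (rank_of M). last Xs = ground M}"

definition flag_composition :: "'a set list \<Rightarrow> nat list" where
  "flag_composition Xs =
     map (\<lambda>j. if j = 0 then card (Xs ! 0) else card (Xs ! j - Xs ! (j - 1))) [0..<length Xs]"

definition nu :: "'a ranked_set \<Rightarrow> nat list \<Rightarrow> nat" where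
  "nu M a = card {Xs \<in> flags M. flag_composition Xs = a}"

definition catenary_data :: "'a ranked_set \<Rightarrow> nat list \<Rightarrow> nat" where
  "catenary_data M = restrict (nu M) (compositions (card (ground M)) (rank_of M))"

text \<open>
  All the spaces \<open>\<G>(n,r)\<close> live inside the free vector space \<open>nat list \<Rightarrow>\<^sub>0 'k\<close> on finite sequences,
  where \<open>[r]\<close> is \<open>Poly_Mapping.single r 1\<close>.
\<close>

definition rank_words :: "nat \<Rightarrow> nat \<Rightarrow> nat list set" where
  "rank_words n r = {w. length w = n \<and> set w \<subseteq> {0, 1} \<and> sum_list w = r}"

definition G_space :: "nat \<Rightarrow> nat \<Rightarrow> (nat list \<Rightarrow>\<^sub>0 'k::field_char_0) set" where
  "G_space n r = {v. Poly_Mapping.keys v \<subseteq> rank_words n r}"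

definition rank_sequence :: "'a ranked_set \<Rightarrow> 'a list \<Rightarrow> nat list" where
  "rank_sequence M p =
     map (\<lambda>j. rk M (set (take (Suc j) p)) - rk M (set (take j p))) [0..<length p]"

definition G_inv :: "'a ranked_set \<Rightarrow> (nat list \<Rightarrow>\<^sub>0 'k::field_char_0)" where
  "G_inv M = (\<Sum>p \<in> permutations_of_set (ground M). Poly_Mapping.single (rank_sequence M p) 1)"

lemma F_num_same_rank: "F_num M k k [s] = f_num M k s"
proof -
  have "{Xs \<in> flat_chains M k k. map card Xs = [s]} = (\<lambda>F. [F]) ` flats_rank_size M k s"
    by (auto simp: flat_chains_def flats_rank_size_def map_eq_Cons_conv)
  then show ?thesis
    by (simp add: F_num_def f_num_def card_image inj_on_def)
qed

context matroid
begin

lemma matroid_restriction: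
  assumes "F \<subseteq> ground M"
  shows "matroid (restriction M F)"
  using assms finite_ground rk_le_card rk_mono rk_submodular
  by unfold_locales (auto simp: restriction_def dest: finite_subset)

lemma matroid_contraction:
  assumes F: "F \<subseteq> ground M"
  shows "matroid (contraction M F)"
proof unfold_locales
  show "finite (ground (contraction M F))"
    using finite_ground by (simp add: contraction_def)
next
  fix X assume "X \<subseteq> ground (contraction M F)"
  then have X: "X \<subseteq> ground M" by (auto simp: contraction_def)
  have "rk M (X \<union> F) \<le> rk M X + rk M F"
    using rk_submodular[OF X F] by simp
  then show "rk (contraction M F) X \<le> card X"
    using rk_le_card[OF X] by (simp add: contraction_def)
next
  fix X Y assume "X \<subseteq> Y" "Y \<subseteq> ground (contraction M F)"
  then have "rk M (X \<union> F) \<le> rk M (Y \<union> F)"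
    using F by (intro rk_mono) (auto simp: contraction_def)
  then show "rk (contraction M F) X \<le> rk (contraction M F) Y"
    by (simp add: contraction_def)
next
  fix X Y assume "X \<subseteq> ground (contraction M F)" "Y \<subseteq> ground (contraction M F)"
  then have X: "X \<union> F \<subseteq> ground M" and Y: "Y \<union> F \<subseteq> ground M"
    using F by (auto simp: contraction_def)
  have e: "(X \<union> F) \<union> (Y \<union> F) = X \<union> Y \<union> F" "(X \<union> F) \<inter> (Y \<union> F) = X \<inter> Y \<union> F"
    by auto
  have "rk M (X \<union> Y \<union> F) + rk M (X \<inter> Y \<union> F) \<le> rk M (X \<union> F) + rk M (Y \<union> F)"
    using rk_submodular[OF X Y] by (simp only: e)
  moreover have "rk M F \<le> rk M (X \<inter> Y \<union> F)"
    using X by (intro rk_mono) auto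
  moreover have "rk M F \<le> rk M (X \<union> F)" "rk M F \<le> rk M (Y \<union> F)" "rk M F \<le> rk M (X \<union> Y \<union> F)"
    using X Y by (auto intro!: rk_mono)
  ultimately show "rk (contraction M F) (X \<union> Y) + rk (contraction M F) (X \<inter> Y)
      \<le> rk (contraction M F) X + rk (contraction M F) Y"
    by (simp add: contraction_def)
qed

lemma rk_insert_le:
  assumes "X \<subseteq> ground M" "x \<in> ground M"
  shows "rk M (insert x X) \<le> rk M X + 1"
  using rk_submodular[of X "{x}"] rk_le_card[of "{x}"] assms by simp

lemma rank_sequence_in_rank_words:
  assumes p: "p \<in> permutations_of_set (ground M)"
  shows "rank_sequence M p \<in> rank_words (card (ground M)) (rank_of M)"
proof -
  have set_p: "set p = ground M" and len: "length p = card (ground M)"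
    using p by (auto simp: permutations_of_set_def simp flip: distinct_card)
  have sub: "set (take j p) \<subseteq> ground M" for j
    using set_p by (metis set_take_subset)
  have mono: "rk M (set (take j p)) \<le> rk M (set (take (Suc j) p))" for j
    by (intro rk_mono sub set_take_subset_set_take) simp
  have unit: "rk M (set (take (Suc j) p)) \<le> rk M (set (take j p)) + 1" if "j < length p" for j
  proof -
    have "p ! j \<in> ground M" using that set_p by (metis nth_mem)
    then show ?thesis
      using rk_insert_le[OF sub, of "p ! j" j] that by (simp add: take_Suc_conv_app_nth)
  qed
  have "set (rank_sequence M p) \<subseteq> {0, 1}"
    using unit by (fastforce simp: rank_sequence_def)
  moreover have "(\<Sum>j<m. rk M (set (take (Suc j) p)) - rk M (set (take j p))) = rk M (set (take m p))" for m
  proof (induction m)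
    case 0
    then show ?case using rk_le_card[of "{}"] by simp
  next
    case (Suc m)
    then show ?case using mono[of m] by simp
  qed
  from this[of "length p"] have "sum_list (rank_sequence M p) = rank_of M"
    by (simp add: rank_sequence_def rank_of_def set_p sum_list_sum_nth atLeast0LessThan)
  ultimately show ?thesis
    by (simp add: rank_words_def len) (simp add: rank_sequence_def len)
qed

lemma G_inv_in_G_space: "G_inv M \<in> G_space (card (ground M)) (rank_of M)"
proof -
  have "Poly_Mapping.keys (G_inv M :: nat list \<Rightarrow>\<^sub>0 'k::field_char_0)
      \<subseteq> (\<Union>p \<in> permutations_of_set (ground M). {rank_sequence M p})"
    unfolding G_inv_def by (rule order_trans[OF keys_sum]) auto
  then show ?thesis
    using rank_sequence_in_rank_words by (auto simp: G_space_def)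
qed

end

end

theory Submission
  imports Defs
begin

text \<open>
  The closures of the initial segments of a linear ordering \<open>p\<close> of the ground set form a flag, the
  flag to which \<open>p\<close> is adapted. Whether \<open>p\<close> is adapted to \<open>X\<^sub>0 \<subset> \<dots> \<subset> X\<^sub>r\<close>, and what its rank
  sequence then is, depends only on which entries of \<open>p\<close> lie in which \<open>X\<^sub>j\<close>. Transporting along a
  bijection from \<open>{0, \<dots>, n - 1}\<close> that maps initial segments to the \<open>X\<^sub>j\<close>, the number of adapted
  orderings with a given rank sequence is a function of the sizes \<open>|X\<^sub>j|\<close> alone. Hence the catenary
  data determine \<open>\<G>(M)\<close>. This linear relation is triangular for the pointwise order of size
  vectors, so \<open>\<G>(M)\<close> conversely determines the catenary data.

  The number of orderings whose initial segments of sizes \<open>s\<^sub>h, \<dots>, s\<^sub>k\<close> are flats of ranks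
  \<open>h, \<dots>, k\<close> is likewise determined by the catenary data, and it is \<open>F\<^sub>h\<^sub>,\<^sub>k(s\<^sub>h, \<dots>, s\<^sub>k)\<close> times a
  positive factor depending only on \<open>n\<close> and the \<open>s\<^sub>j\<close>. Finally, if \<open>F\<close> is the only flat of rank
  \<open>k\<close> and size \<open>s\<close>, then flags of \<open>M|F\<close> and \<open>M/F\<close> are chains of flats of \<open>M\<close> counted by
  \<open>F\<^sub>0\<^sub>,\<^sub>k\<close> and \<open>F\<^sub>k\<^sub>,\<^sub>r\<close>.
\<close>

section \<open>Linear orderings adapted to a chain of sets\<close>

text \<open>
  For a flag, this says that each of its flats is the closure of an initial segment of \<open>p\<close>.
\<close>

definition adapted :: "'a set list \<Rightarrow> 'a list \<Rightarrow> bool" where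
  "adapted Xs p \<longleftrightarrow>
     (\<forall>j. Suc j < length Xs \<longrightarrow> \<not> set (takeWhile (\<lambda>x. x \<in> Xs ! Suc j) p) \<subseteq> Xs ! j)"

text \<open>For an increasing chain this is the index of the first member containing
  \<open>A\<close> (the length if there is none); on initial segments of an ordering adapted to a
  flag it is the rank. As a count it is monotone in \<open>A\<close> for arbitrary lists.\<close>

definition chain_level :: "'a set list \<Rightarrow> 'a set \<Rightarrow> nat" where
  "chain_level Xs A = card {j. j < length Xs \<and> \<not> A \<subseteq> Xs ! j}"

definition level_sequence :: "'a set list \<Rightarrow> 'a list \<Rightarrow> nat list" where
  "level_sequence Xs p =
     map (\<lambda>j. chain_level Xs (set (take (Suc j) p)) - chain_level Xs (set (take j p)))
       [0..<length p]"

text \<open>The catenary data indexed by the sizes \<open>|X_j|\<close> in place of their successive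
  differences; in this form the relation to the G-invariant is triangular.\<close>

definition flag_size_count :: "'a ranked_set \<Rightarrow> nat list \<Rightarrow> nat" where
  "flag_size_count M t = card {Xs \<in> flags M. map card Xs = t}"

text \<open>Induction from the top of the chain: the bijection obtained with the last member
  \<open>Y\<close> as ground set is continued by any bijection from the remaining indices onto
  \<open>E - Y\<close>.\<close>

lemma chain_bij:
  assumes "finite E" and "sorted_wrt (\<subset>) Xs" and "\<forall>X \<in> set Xs. X \<subseteq> E"
  shows "\<exists>q. bij_betw q {..<card E} E \<and> (\<forall>X \<in> set Xs. q ` {..<card X} = X)"
  using assms
proof (induction Xs arbitrary: E rule: rev_induct)
  case Nil
  then show ?case
    using ex_bij_betw_nat_finite[of E] by (auto simp: atLeast0LessThan)
next
  case (snoc Y Xs)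
  have YE: "Y \<subseteq> E" and fY: "finite Y"
    using snoc.prems finite_subset by auto
  have "sorted_wrt (\<subset>) Xs" "\<forall>X \<in> set Xs. X \<subseteq> Y"
    using snoc.prems by (auto simp: sorted_wrt_append)
  from snoc.IH[OF fY this] obtain q where
    q: "bij_betw q {..<card Y} Y" "\<forall>X \<in> set Xs. q ` {..<card X} = X" by blast
  have "card {card Y..<card E} = card (E - Y)"
    using YE fY by (simp add: card_Diff_subset)
  then obtain g where g: "bij_betw g {card Y..<card E} (E - Y)"
    using finite_same_card_bij snoc.prems(1) by (metis finite_Diff finite_atLeastLessThan)
  define f where "f i = (if i < card Y then q i else g i)" for i
  have le: "card Y \<le> card E" using YE snoc.prems(1) card_mono by blast
  have f1: "bij_betw f {..<card Y} Y"
    using q(1) by (rule bij_betw_cong[THEN iffD1, rotated]) (simp add: f_def)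
  have f2: "bij_betw f {card Y..<card E} (E - Y)"
    using g by (rule bij_betw_cong[THEN iffD1, rotated]) (simp add: f_def)
  have "bij_betw f ({..<card Y} \<union> {card Y..<card E}) (Y \<union> (E - Y))"
    by (rule bij_betw_combine[OF f1 f2]) auto
  moreover have "{..<card Y} \<union> {card Y..<card E} = {..<card E}" "Y \<union> (E - Y) = E"
    using le YE by auto
  ultimately have "bij_betw f {..<card E} E" by simp
  moreover have "f ` {..<card X} = X" if "X \<in> set Xs" for X
  proof -
    have "card X \<le> card Y" using that \<open>\<forall>X \<in> set Xs. X \<subseteq> Y\<close> fY card_mono by blast
    then have "f ` {..<card X} = q ` {..<card X}"
      by (intro image_cong) (auto simp: f_def)
    then show ?thesis using q(2) that by simp
  qed
  moreover have "f ` {..<card Y} = Y" using f1 by (simp add: bij_betw_def)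
  ultimately show ?case by auto
qed

lemma card_permutations_bij:
  assumes q: "bij_betw q A B"
  shows "card {p \<in> permutations_of_set B. P p} = card {p \<in> permutations_of_set A. P (map q p)}"
proof -
  have inj: "inj_on q A" and im: "q ` A = B" using q by (auto simp: bij_betw_def)
  have "{p \<in> permutations_of_set B. P p} = map q ` {p \<in> permutations_of_set A. P (map q p)}"
    using permutations_of_set_image_inj[OF inj] im by auto
  moreover have "inj_on (map q) {p \<in> permutations_of_set A. P (map q p)}"
  proof (rule inj_on_mapI)
    have "\<Union> (set ` {p \<in> permutations_of_set A. P (map q p)}) \<subseteq> A"
      by (auto simp: permutations_of_set_def)
    then show "inj_on q (\<Union> (set ` {p \<in> permutations_of_set A. P (map q p)}))"
      by (rule inj_on_subset[OF inj])
  qed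
  ultimately show ?thesis by (simp add: card_image)
qed

context
  fixes q :: "nat \<Rightarrow> 'a" and n :: nat and Xs :: "'a set list"
  assumes q_inj: "inj_on q {..<n}"
    and q_image: "\<And>X. X \<in> set Xs \<Longrightarrow> q ` {..<card X} = X \<and> card X \<le> n"
begin

lemma q_mem_iff: "x < n \<Longrightarrow> X \<in> set Xs \<Longrightarrow> q x \<in> X \<longleftrightarrow> x < card X"
  using inj_on_image_mem_iff[OF q_inj, of x "{..<card X}"] q_image[of X] by simp

text \<open>Under \<open>q\<close>, membership in \<open>X\<close> becomes
  \<open>x < card X\<close>, and adaptedness tests nothing but such memberships. The same holds for
  \<open>chain_level\<close> below, so only the sizes of the members matter.\<close>

lemma adapted_map_iff:
  assumes p: "set p \<subseteq> {..<n}"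
  shows "adapted Xs (map q p) \<longleftrightarrow> adapted (map (lessThan \<circ> card) Xs) p"
proof -
  have "set (takeWhile (\<lambda>x. x \<in> Xs ! Suc j) (map q p)) \<subseteq> Xs ! j \<longleftrightarrow>
     set (takeWhile (\<lambda>x. x < card (Xs ! Suc j)) p) \<subseteq> {..<card (Xs ! j)}"
    if j: "Suc j < length Xs" for j
  proof -
    have "takeWhile ((\<lambda>x. x \<in> Xs ! Suc j) \<circ> q) p = takeWhile (\<lambda>x. x < card (Xs ! Suc j)) p"
      using p q_mem_iff j by (intro takeWhile_cong) auto
    moreover have "q ` set (takeWhile P p) \<subseteq> Xs ! j \<longleftrightarrow> set (takeWhile P p) \<subseteq> {..<card (Xs ! j)}" for P
      using p q_mem_iff[of _ "Xs ! j"] j set_takeWhileD[of _ P p] by (fastforce simp: subset_iff)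
    ultimately show ?thesis by (simp add: takeWhile_map)
  qed
  then show ?thesis by (simp add: adapted_def)
qed

lemma chain_level_image:
  assumes A: "A \<subseteq> {..<n}"
  shows "chain_level Xs (q ` A) = chain_level (map (lessThan \<circ> card) Xs) A"
proof -
  have "q ` A \<subseteq> Xs ! j \<longleftrightarrow> A \<subseteq> {..<card (Xs ! j)}" if "j < length Xs" for j
    using A q_mem_iff[of _ "Xs ! j"] that by (auto simp: subset_iff)
  then have "{j. j < length Xs \<and> \<not> q ` A \<subseteq> Xs ! j} =
      {j. j < length Xs \<and> \<not> A \<subseteq> {..<card (Xs ! j)}}" by auto
  moreover have "{j. j < length Xs \<and> \<not> A \<subseteq> map (lessThan \<circ> card) Xs ! j} =
      {j. j < length Xs \<and> \<not> A \<subseteq> {..<card (Xs ! j)}}" by auto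
  ultimately show ?thesis by (simp add: chain_level_def)
qed

lemma level_sequence_map:
  assumes p: "set p \<subseteq> {..<n}"
  shows "level_sequence Xs (map q p) = level_sequence (map (lessThan \<circ> card) Xs) p"
proof -
  have "set (take i p) \<subseteq> {..<n}" for i using p set_take_subset by fast
  then show ?thesis
    by (simp add: level_sequence_def take_map chain_level_image)
qed

end

section \<open>Closure and the flag of a linear ordering\<close>

context matroid
begin

definition closure_of :: "'a set \<Rightarrow> 'a set" where
  "closure_of A = {x \<in> ground M. rk M (insert x A) = rk M A}"

text \<open>The elements of \<open>B\<close> are added one at a time. Submodularity is applied to
  \<open>A \<union> B\<close> and \<open>insert x A\<close>: their intersection contains
  \<open>A\<close>, and \<open>insert x A\<close> has the rank of \<open>A\<close>.\<close>

lemma rk_Un_closed: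
  assumes "A \<subseteq> ground M" "B \<subseteq> closure_of A"
  shows "rk M (A \<union> B) = rk M A"
proof -
  have "finite B" using assms finite_ground finite_subset by (fastforce simp: closure_of_def)
  then show ?thesis using assms(2)
  proof (induction B rule: finite_induct)
    case (insert x B)
    then have x: "x \<in> ground M" "rk M (insert x A) = rk M A" and B: "B \<subseteq> ground M"
      by (auto simp: closure_of_def)
    have s: "A \<union> B \<subseteq> ground M" "insert x A \<subseteq> ground M" using assms(1) B x by auto
    have e: "(A \<union> B) \<union> insert x A = A \<union> insert x B" by auto
    have "rk M (A \<union> insert x B) + rk M ((A \<union> B) \<inter> insert x A) \<le> rk M (A \<union> B) + rk M (insert x A)"
      using rk_submodular[OF s] by (simp only: e)
    moreover have "rk M A \<le> rk M ((A \<union> B) \<inter> insert x A)"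
      using s by (intro rk_mono) auto
    moreover have "rk M A \<le> rk M (A \<union> insert x B)"
      using s x by (intro rk_mono) auto
    ultimately show ?case using insert x by auto
  qed simp
qed

lemma subset_closure_of: "A \<subseteq> ground M \<Longrightarrow> A \<subseteq> closure_of A"
  by (auto simp: closure_of_def insert_absorb)

lemma closure_of_subset_ground: "closure_of A \<subseteq> ground M"
  by (auto simp: closure_of_def)

lemma rk_closure_of:
  assumes "A \<subseteq> ground M"
  shows "rk M (closure_of A) = rk M A"
  using rk_Un_closed[OF assms order_refl] subset_closure_of[OF assms] by (simp add: Un_absorb1)

lemma flat_closure_of:
  assumes A: "A \<subseteq> ground M"
  shows "flat M (closure_of A)"
  unfolding flat_def
proof (intro conjI ballI closure_of_subset_ground)
  fix x assume x: "x \<in> ground M - closure_of A"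
  have "rk M A \<le> rk M (insert x A)" using x A by (intro rk_mono) auto
  then have "rk M A < rk M (insert x A)" using x by (auto simp: closure_of_def)
  also have "\<dots> \<le> rk M (insert x (closure_of A))"
    using x subset_closure_of[OF A] closure_of_subset_ground by (intro rk_mono) auto
  finally show "rk M (closure_of A) < rk M (insert x (closure_of A))"
    by (simp add: rk_closure_of A)
qed

text \<open>Submodularity for \<open>B\<close> and \<open>insert x A\<close>, whose intersection
  contains \<open>A\<close>: an element that adds no rank to \<open>A\<close> adds none to
  \<open>B\<close>.\<close>

lemma closure_of_mono:
  assumes "A \<subseteq> B" "B \<subseteq> ground M"
  shows "closure_of A \<subseteq> closure_of B"
proof
  fix x assume x: "x \<in> closure_of A"
  have "rk M (B \<union> insert x A) + rk M (B \<inter> insert x A) \<le> rk M B + rk M (insert x A)"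
    using assms x by (intro rk_submodular) (auto simp: closure_of_def)
  moreover have "rk M A \<le> rk M (B \<inter> insert x A)" using assms by (intro rk_mono) auto
  moreover have "B \<union> insert x A = insert x B" using assms by auto
  moreover have "rk M B \<le> rk M (insert x B)"
    using assms x by (intro rk_mono) (auto simp: closure_of_def)
  ultimately show "x \<in> closure_of B" using x by (auto simp: closure_of_def)
qed

lemma closure_of_eq:
  assumes "A \<subseteq> B" "B \<subseteq> ground M" "rk M A = rk M B"
  shows "closure_of A = closure_of B"
proof
  show "closure_of A \<subseteq> closure_of B" using assms by (intro closure_of_mono)
  show "closure_of B \<subseteq> closure_of A"
  proof
    fix x assume x: "x \<in> closure_of B"
    have s: "insert x A \<subseteq> insert x B" "insert x B \<subseteq> ground M" "A \<subseteq> insert x A"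
      using assms x by (auto simp: closure_of_def)
    have "rk M (insert x A) \<le> rk M (insert x B)" "rk M A \<le> rk M (insert x A)"
      using s by (blast intro: rk_mono)+
    then show "x \<in> closure_of A" using x assms(3) by (auto simp: closure_of_def)
  qed
qed

lemma closure_of_flat:
  assumes "flat M X"
  shows "closure_of X = X"
proof
  show "X \<subseteq> closure_of X" using assms by (intro subset_closure_of) (simp add: flat_def)
  show "closure_of X \<subseteq> X"
  proof
    fix x assume "x \<in> closure_of X"
    then have "x \<in> ground M" "\<not> rk M X < rk M (insert x X)" by (auto simp: closure_of_def)
    then show "x \<in> X" using assms unfolding flat_def by blast
  qed
qed

lemma closure_of_eq_flat:
  assumes "flat M X" "A \<subseteq> X" "rk M A = rk M X"
  shows "closure_of A = X"
  using closure_of_eq[of A X] closure_of_flat[of X] assms unfolding flat_def by metis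

lemma rk_empty: "rk M {} = 0"
  using rk_le_card[of "{}"] by simp

lemma flag_length: "Xs \<in> flags M \<Longrightarrow> length Xs = Suc (rank_of M)"
  by (simp add: flags_def flat_chains_def)

lemma flag_nth:
  assumes "Xs \<in> flags M" "j \<le> rank_of M"
  shows "flat M (Xs ! j)" "rk M (Xs ! j) = j" "Xs ! j \<subseteq> ground M"
proof -
  show "flat M (Xs ! j)" "rk M (Xs ! j) = j"
    using assms by (simp_all add: flags_def flat_chains_def)
  then show "Xs ! j \<subseteq> ground M" by (simp add: flat_def)
qed

lemma flag_strict_mono:
  assumes "Xs \<in> flags M" "i < j" "j \<le> rank_of M"
  shows "Xs ! i \<subset> Xs ! j"
proof (rule sorted_wrt_nth_less[of "(\<subset>)" Xs i j])
  show "sorted_wrt (\<subset>) Xs" using assms(1) by (simp add: flags_def flat_chains_def)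
  show "i < j" "j < length Xs" using assms flag_length by auto
qed

lemma flag_mono:
  assumes "Xs \<in> flags M" "i \<le> j" "j \<le> rank_of M"
  shows "Xs ! i \<subseteq> Xs ! j"
  using flag_strict_mono[of Xs i j] assms by (cases "i = j") (simp_all add: psubset_imp_subset)

lemma flag_last:
  assumes "Xs \<in> flags M"
  shows "Xs ! rank_of M = ground M"
proof -
  have l: "length Xs = Suc (rank_of M)" using assms by (rule flag_length)
  then have "last Xs = Xs ! rank_of M" by (subst last_conv_nth) auto
  moreover have "last Xs = ground M" using assms by (simp add: flags_def)
  ultimately show ?thesis by simp
qed

lemma finite_flags: "finite (flags M)"
proof (rule finite_subset)
  show "flags M \<subseteq> {Xs. set Xs \<subseteq> Pow (ground M) \<and> length Xs = Suc (rank_of M)}"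
  proof
    fix Xs assume X: "Xs \<in> flags M"
    have "set Xs \<subseteq> Pow (ground M)"
      using flag_nth(3)[OF X] flag_length[OF X] by (metis PowI in_set_conv_nth less_Suc_eq_le subsetI)
    then show "Xs \<in> {Xs. set Xs \<subseteq> Pow (ground M) \<and> length Xs = Suc (rank_of M)}"
      using flag_length[OF X] by simp
  qed
  show "finite {Xs. set Xs \<subseteq> Pow (ground M) \<and> length Xs = Suc (rank_of M)}"
    using finite_ground by (intro finite_lists_length_eq) simp
qed

section \<open>The unique flag to which a linear ordering is adapted\<close>

lemma set_take_ground: "p \<in> permutations_of_set (ground M) \<Longrightarrow> set (take i p) \<subseteq> ground M"
  using set_take_subset[of i p] permutations_of_setD(1)[of p "ground M"] by simp

text \<open>Induction on \<open>j\<close>. The initial segment inside \<open>Xs ! j\<close> has rank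
  \<open>j\<close> and so spans that flat. Adaptedness puts an entry outside this flat into the next
  segment, which raises the rank; the rank of \<open>Xs ! Suc j\<close> is the upper bound.\<close>

lemma adapted_rk:
  assumes X: "Xs \<in> flags M" and ad: "adapted Xs p"
  shows "j \<le> rank_of M \<Longrightarrow> rk M (set (takeWhile (\<lambda>x. x \<in> Xs ! j) p)) = j"
proof (induction j)
  case 0
  have "rk M (set (takeWhile (\<lambda>x. x \<in> Xs ! 0) p)) \<le> rk M (Xs ! 0)"
    using flag_nth[OF X, of 0] by (intro rk_mono) (auto dest: set_takeWhileD)
  then show ?case using flag_nth[OF X, of 0] by simp
next
  case (Suc j)
  let ?T = "\<lambda>j. set (takeWhile (\<lambda>x. x \<in> Xs ! j) p)"
  have sub: "?T j \<subseteq> Xs ! j" for j by (auto dest: set_takeWhileD)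
  have T: "?T (Suc j) \<subseteq> ground M" using sub flag_nth[OF X Suc.prems] by blast
  have ne: "\<not> ?T (Suc j) \<subseteq> Xs ! j"
    using ad Suc.prems flag_length[OF X] by (auto simp: adapted_def)
  then obtain x where x: "x \<in> ?T (Suc j)" "x \<notin> Xs ! j" by blast
  have "?T j \<subseteq> ?T (Suc j)"
  proof -
    have "takeWhile (\<lambda>x. x \<in> Xs ! j) (takeWhile (\<lambda>x. x \<in> Xs ! Suc j) p)
        = takeWhile (\<lambda>x. x \<in> Xs ! Suc j \<and> x \<in> Xs ! j) p"
      by (induction p) auto
    also have "\<dots> = takeWhile (\<lambda>x. x \<in> Xs ! j) p"
      using flag_mono[OF X, of j "Suc j"] Suc.prems by (intro takeWhile_cong) auto
    finally show ?thesis by (metis set_takeWhileD subsetI)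
  qed
  then have le: "rk M (insert x (?T j)) \<le> rk M (?T (Suc j))"
    using x T by (intro rk_mono) auto
  have "closure_of (?T j) = Xs ! j"
    using Suc sub flag_nth[OF X, of j] by (intro closure_of_eq_flat) auto
  then have "rk M (insert x (?T j)) \<noteq> rk M (?T j)"
    using x T by (auto simp: closure_of_def)
  moreover have "rk M (?T j) \<le> rk M (insert x (?T j))"
    using \<open>?T j \<subseteq> ?T (Suc j)\<close> x T by (intro rk_mono) auto
  ultimately have "Suc j \<le> rk M (?T (Suc j))" using le Suc by simp
  moreover have "rk M (?T (Suc j)) \<le> rk M (Xs ! Suc j)"
    using sub flag_nth[OF X Suc.prems] by (intro rk_mono) auto
  ultimately show ?case using flag_nth[OF X Suc.prems] by simp
qed

text \<open>Two initial segments of one ordering are nested, so equal ranks give equal closures.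
  Here one segment spans \<open>Y\<close> and another spans \<open>Xs ! j\<close> by
  \<open>adapted_rk\<close>.\<close>

lemma adapted_flat_eq:
  assumes X: "Xs \<in> flags M" and p: "p \<in> permutations_of_set (ground M)" and ad: "adapted Xs p"
    and Y: "flat M Y" "set (take i p) \<subseteq> Y" "rk M (set (take i p)) = j" "rk M Y = j"
    and j: "j \<le> rank_of M"
  shows "Y = Xs ! j"
proof -
  obtain m where m: "takeWhile (\<lambda>x. x \<in> Xs ! j) p = take m p" using takeWhile_eq_take by blast
  have r: "rk M (set (take m p)) = j" using adapted_rk[OF X ad j] m by simp
  have s: "set (take m p) \<subseteq> Xs ! j" by (metis m set_takeWhileD subsetI)
  have "closure_of (set (take m p)) = Xs ! j"
    using flag_nth[OF X j] r s by (intro closure_of_eq_flat) auto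
  moreover have "closure_of (set (take i p)) = Y"
    using Y by (intro closure_of_eq_flat) auto
  moreover have "closure_of (set (take i p)) = closure_of (set (take m p))"
  proof (cases "i \<le> m")
    case True
    then show ?thesis using r Y set_take_ground[OF p]
      by (intro closure_of_eq) (auto intro!: set_take_subset_set_take)
  next
    case False
    then show ?thesis using r Y set_take_ground[OF p]
      by (intro closure_of_eq[symmetric]) (auto intro!: set_take_subset_set_take)
  qed
  ultimately show ?thesis by simp
qed

lemma adapted_unique:
  assumes X: "Xs \<in> flags M" "adapted Xs p" and Y: "Ys \<in> flags M" "adapted Ys p"
    and p: "p \<in> permutations_of_set (ground M)"
  shows "Ys = Xs"
proof (rule nth_equalityI)
  show "length Ys = length Xs" using X Y flag_length by simp
  fix j assume "j < length Ys"
  then have j: "j \<le> rank_of M" using Y flag_length by fastforce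
  obtain m where m: "takeWhile (\<lambda>x. x \<in> Ys ! j) p = take m p" using takeWhile_eq_take by blast
  show "Ys ! j = Xs ! j"
  proof (rule adapted_flat_eq[OF X(1) p X(2) _ _ _ _ j])
    show "flat M (Ys ! j)" "rk M (Ys ! j) = j" using flag_nth[OF Y(1) j] by auto
    show "set (take m p) \<subseteq> Ys ! j" by (metis m set_takeWhileD subsetI)
    show "rk M (set (take m p)) = j" using adapted_rk[OF Y j] m by simp
  qed
qed

text \<open>A discrete intermediate value argument: along \<open>p\<close> the rank starts at 0,
  ends at \<open>rank_of M\<close> and grows by at most 1 with each entry.\<close>

lemma prefix_of_rank:
  assumes p: "p \<in> permutations_of_set (ground M)" and j: "j \<le> rank_of M"
  shows "\<exists>i. rk M (set (take i p)) = j"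
proof -
  have "\<exists>i'\<le>i. rk M (set (take i' p)) = j" if "j \<le> rk M (set (take i p))" for i
    using that
  proof (induction i)
    case 0
    then show ?case by (simp add: rk_empty)
  next
    case (Suc i)
    show ?case
    proof (cases "j \<le> rk M (set (take i p))")
      case True
      then show ?thesis using Suc.IH by (meson le_SucI)
    next
      case False
      have "rk M (set (take (Suc i) p)) \<le> rk M (set (take i p)) + 1"
      proof (cases "i < length p")
        case True
        then have "p ! i \<in> ground M" using nth_mem[OF True] permutations_of_setD(1)[OF p] by simp
        then show ?thesis
          using rk_insert_le[OF set_take_ground[OF p, of i]] True
          by (simp add: take_Suc_conv_app_nth)
      qed simp
      then have "rk M (set (take (Suc i) p)) = j" using False Suc.prems by simp
      then show ?thesis by auto
    qed
  qed
  then have "\<exists>i'\<le>length p. rk M (set (take i' p)) = j"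
    using permutations_of_setD(1)[OF p] j by (simp add: rank_of_def)
  then show ?thesis by blast
qed

lemma adapted_exists:
  assumes p: "p \<in> permutations_of_set (ground M)"
  shows "\<exists>Xs \<in> flags M. adapted Xs p"
proof -
  obtain i where i: "\<And>j. j \<le> rank_of M \<Longrightarrow> rk M (set (take (i j) p)) = j"
    using prefix_of_rank[OF p] by metis
  note sg = set_take_ground[OF p]
  \<comment> \<open>Any two initial segments of rank \<open>j\<close> have the same closure, so the
    choice made in \<open>i\<close> does not influence the flag.\<close>
  define X where "X j = closure_of (set (take (i j) p))" for j
  have flX: "flat M (X j)" for j unfolding X_def by (intro flat_closure_of sg)
  have rX: "rk M (X j) = j" if "j \<le> rank_of M" for j
    using rk_closure_of[OF sg] i[OF that] by (simp add: X_def)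
  have less: "X a \<subset> X b" if "a < b" "b \<le> rank_of M" for a b
  proof -
    have "\<not> i b \<le> i a"
    proof
      assume "i b \<le> i a"
      then have "rk M (set (take (i b) p)) \<le> rk M (set (take (i a) p))"
        using sg by (intro rk_mono set_take_subset_set_take) auto
      then show False using i[of a] i[of b] that by simp
    qed
    then have "X a \<subseteq> X b" unfolding X_def
      using sg by (intro closure_of_mono set_take_subset_set_take) auto
    moreover have "X a \<noteq> X b" using rX[of a] rX[of b] that by auto
    ultimately show ?thesis by blast
  qed
  define Xs where "Xs = map X [0..<Suc (rank_of M)]"
  have nth: "Xs ! j = X j" if "j \<le> rank_of M" for j
    using that unfolding Xs_def by (simp del: upt_Suc)
  have len: "length Xs = Suc (rank_of M)" "Xs \<noteq> []" by (auto simp: Xs_def)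
  have last: "X (rank_of M) = ground M"
  proof -
    have "closure_of (X (rank_of M)) = closure_of (ground M)"
      using rX[of "rank_of M"] flX by (intro closure_of_eq) (auto simp: rank_of_def flat_def)
    then show ?thesis
      using closure_of_flat[OF flX] subset_closure_of[of "ground M"] closure_of_subset_ground
      by (metis order_refl subset_antisym)
  qed
  have "Xs \<in> flags M"
    unfolding flags_def flat_chains_def
    using flX rX nth less last
    by (simp add: sorted_wrt_iff_nth_less last_conv_nth len)
  moreover have "adapted Xs p"
    unfolding adapted_def
  proof (intro allI impI notI)
    fix j assume "Suc j < length Xs"
      and *: "set (takeWhile (\<lambda>x. x \<in> Xs ! Suc j) p) \<subseteq> Xs ! j"
    then have j: "Suc j \<le> rank_of M" by (simp add: Xs_def)
    \<comment> \<open>This segment lies in its own closure, so \<open>takeWhile\<close> runs through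
      all of it; inside \<open>X j\<close> its rank would be at most \<open>j\<close>.\<close>
    have "set (take (i (Suc j)) p) \<subseteq> X (Suc j)"
      unfolding X_def by (intro subset_closure_of sg)
    then have "takeWhile (\<lambda>x. x \<in> X (Suc j)) (take (i (Suc j)) p @ drop (i (Suc j)) p) =
        take (i (Suc j)) p @ takeWhile (\<lambda>x. x \<in> X (Suc j)) (drop (i (Suc j)) p)"
      by (intro takeWhile_append2) auto
    then have "set (take (i (Suc j)) p) \<subseteq> X j" using * nth j by auto
    then have "rk M (set (take (i (Suc j)) p)) \<le> rk M (X j)"
      using flX[of j] by (intro rk_mono) (auto simp: flat_def)
    then show False using i[OF j] rX[of j] j by simp
  qed
  ultimately show ?thesis by blast
qed

text \<open>Let \<open>m\<close> be the least index with \<open>?A \<subseteq> Xs ! m\<close>; it is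
  the level, and it bounds the rank. If \<open>m = Suc j\<close>, then \<open>?A\<close> contains a
  segment spanning \<open>Xs ! j\<close> together with an element outside that flat, so its rank
  exceeds \<open>j\<close>.\<close>

lemma chain_level_flag:
  assumes X: "Xs \<in> flags M" and p: "p \<in> permutations_of_set (ground M)" and ad: "adapted Xs p"
  shows "chain_level Xs (set (take i p)) = rk M (set (take i p))"
proof -
  let ?A = "set (take i p)"
  have AX: "?A \<subseteq> Xs ! rank_of M" using set_take_ground[OF p] flag_last[OF X] by simp
  define m where "m = (LEAST j. ?A \<subseteq> Xs ! j)"
  have m: "?A \<subseteq> Xs ! m" unfolding m_def using AX by (rule LeastI)
  have mr: "m \<le> rank_of M" unfolding m_def using AX by (rule Least_le)
  have iff: "?A \<subseteq> Xs ! j \<longleftrightarrow> m \<le> j" if "j \<le> rank_of M" for j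
    using m flag_mono[OF X _ that, of m] Least_le[of "\<lambda>j. ?A \<subseteq> Xs ! j" j] by (auto simp: m_def)
  have "j < length Xs \<and> \<not> ?A \<subseteq> Xs ! j \<longleftrightarrow> j < m" for j
    using iff[of j] mr flag_length[OF X] by (cases "j \<le> rank_of M") (simp_all add: not_le)
  then have "{j. j < length Xs \<and> \<not> ?A \<subseteq> Xs ! j} = {..<m}" by blast
  then have "chain_level Xs ?A = m" by (simp add: chain_level_def)
  moreover have "rk M ?A = m"
  proof (rule antisym)
    show "rk M ?A \<le> m"
      using rk_mono[OF m] flag_nth[OF X mr] by auto
    show "m \<le> rk M ?A"
    proof (cases m)
      case (Suc j)
      then have j: "j \<le> rank_of M" using mr by simp
      obtain l where l: "takeWhile (\<lambda>x. x \<in> Xs ! j) p = take l p" using takeWhile_eq_take by blast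
      have r: "rk M (set (take l p)) = j" using adapted_rk[OF X ad j] l by simp
      have s: "set (take l p) \<subseteq> Xs ! j" by (metis l set_takeWhileD subsetI)
      obtain x where x: "x \<in> ?A" "x \<notin> Xs ! j" using iff[OF j] Suc by auto
      \<comment> \<open>Otherwise \<open>?A\<close> would be part of the segment of length
        \<open>l\<close>, which lies in \<open>Xs ! j\<close>.\<close>
      have "l \<le> i"
        using x s set_take_subset_set_take[of i l p] by (cases "l \<le> i") auto
      then have "insert x (set (take l p)) \<subseteq> ?A" using x set_take_subset_set_take[of l i p] by auto
      then have le: "rk M (insert x (set (take l p))) \<le> rk M ?A"
        using set_take_ground[OF p] by (intro rk_mono)
      have "closure_of (set (take l p)) = Xs ! j"
        using flag_nth[OF X j] r s by (intro closure_of_eq_flat) auto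
      then have "rk M (insert x (set (take l p))) \<noteq> j"
        using x r set_take_ground[OF p, of i] by (auto simp: closure_of_def)
      moreover have "rk M (set (take l p)) \<le> rk M (insert x (set (take l p)))"
        using x set_take_ground[OF p, of i] set_take_ground[OF p, of l] by (intro rk_mono) auto
      ultimately show ?thesis using r le Suc by simp
    qed simp
  qed
  ultimately show ?thesis by simp
qed

lemma rank_sequence_adapted:
  assumes "Xs \<in> flags M" "p \<in> permutations_of_set (ground M)" "adapted Xs p"
  shows "rank_sequence M p = level_sequence Xs p"
  by (simp add: rank_sequence_def level_sequence_def chain_level_flag[OF assms])

text \<open>Each ordering is adapted to exactly one flag, so the orderings split into one class per
  flag. Within a class, \<open>Q\<close> may be traded for a condition that refers to the flag and
  no longer to the matroid.\<close>

lemma card_permutations_by_flag: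
  assumes "\<And>Xs p. Xs \<in> flags M \<Longrightarrow> p \<in> permutations_of_set (ground M) \<Longrightarrow> adapted Xs p \<Longrightarrow>
      Q p \<longleftrightarrow> R Xs p"
  shows "card {p \<in> permutations_of_set (ground M). Q p} =
    (\<Sum>Xs \<in> flags M. card {p \<in> permutations_of_set (ground M). adapted Xs p \<and> R Xs p})"
proof -
  have "{p \<in> permutations_of_set (ground M). Q p} =
      (\<Union>Xs \<in> flags M. {p \<in> permutations_of_set (ground M). adapted Xs p \<and> R Xs p})"
  proof (rule set_eqI, rule iffI)
    fix p assume "p \<in> {p \<in> permutations_of_set (ground M). Q p}"
    then have p: "p \<in> permutations_of_set (ground M)" "Q p" by auto
    then obtain Xs where "Xs \<in> flags M" "adapted Xs p" using adapted_exists by blast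
    with p show "p \<in> (\<Union>Xs \<in> flags M. {p \<in> permutations_of_set (ground M). adapted Xs p \<and> R Xs p})"
      using assms[of Xs p] by blast
  next
    fix p assume "p \<in> (\<Union>Xs \<in> flags M. {p \<in> permutations_of_set (ground M). adapted Xs p \<and> R Xs p})"
    then show "p \<in> {p \<in> permutations_of_set (ground M). Q p}"
      using assms[of _ p] by auto
  qed
  also have "card \<dots> = (\<Sum>Xs \<in> flags M. card {p \<in> permutations_of_set (ground M). adapted Xs p \<and> R Xs p})"
  proof (intro card_UN_disjoint finite_flags ballI impI)
    fix Xs Ys assume "Xs \<in> flags M" "Ys \<in> flags M" "Xs \<noteq> Ys"
    then show "{p \<in> permutations_of_set (ground M). adapted Xs p \<and> R Xs p} \<inter>
        {p \<in> permutations_of_set (ground M). adapted Ys p \<and> R Ys p} = {}"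
      using adapted_unique by blast
  qed simp
  finally show ?thesis .
qed

end

section \<open>Catenary data and the G-invariant\<close>

lemma chain_level_empty [simp]: "chain_level Xs {} = 0"
  by (simp add: chain_level_def)

lemma chain_level_mono: "A \<subseteq> B \<Longrightarrow> chain_level Xs A \<le> chain_level Xs B"
  unfolding chain_level_def by (rule card_mono) auto

text \<open>The differences are truncated, so they determine the levels only because levels are
  monotone. Both levels start at 0 and are constant past the end of the ordering.\<close>

lemma level_sequence_eqD:
  assumes eq: "level_sequence Xs p = level_sequence Ys p'"
  shows "chain_level Xs (set (take i p)) = chain_level Ys (set (take i p'))"
proof -
  have len: "length p = length p'"
    using arg_cong[OF eq, of length] by (simp add: level_sequence_def)
  show ?thesis
  proof (induction i)
    case (Suc i)
    show ?case
    proof (cases "i < length p")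
      case True
      have "level_sequence Xs p ! i = level_sequence Ys p' ! i" using eq by simp
      then have "chain_level Xs (set (take (Suc i) p)) - chain_level Xs (set (take i p)) =
          chain_level Ys (set (take (Suc i) p')) - chain_level Ys (set (take i p'))"
        using True len by (simp add: level_sequence_def)
      moreover have "chain_level Xs (set (take i p)) \<le> chain_level Xs (set (take (Suc i) p))"
        "chain_level Ys (set (take i p')) \<le> chain_level Ys (set (take (Suc i) p'))"
        by (intro chain_level_mono set_take_subset_set_take; simp)+
      ultimately show ?thesis using Suc by linarith
    qed (use Suc len in simp)
  qed simp
qed

section \<open>The triangular system relating flag sizes to rank sequences\<close>

definition size_vectors :: "nat \<Rightarrow> nat \<Rightarrow> nat list set" where
  "size_vectors n r = {t. sorted_wrt (<) t \<and> set t \<subseteq> {..n} \<and> length t = Suc r}"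

text \<open>The coefficients of the linear system: \<open>t\<close> stands for a flag with sizes
  \<open>t\<close>, moved to initial segments of \<open>{..<n}\<close>.\<close>

definition adapted_count :: "nat \<Rightarrow> nat list \<Rightarrow> nat list \<Rightarrow> nat" where
  "adapted_count n w t = card {p \<in> permutations_of_set {..<n}.
     adapted (map lessThan t) p \<and> level_sequence (map lessThan t) p = w}"

lemma finite_size_vectors: "finite (size_vectors n r)"
  by (rule finite_subset[of _ "{t. set t \<subseteq> {..n} \<and> length t = Suc r}"])
    (auto simp: size_vectors_def intro: finite_lists_length_eq)

lemma upt_in_permutations: "[0..<n] \<in> permutations_of_set {..<n}"
  by (auto simp: permutations_of_set_def)

lemma adapted_upt:
  assumes t: "t \<in> size_vectors n r"
  shows "adapted (map lessThan t) [0..<n]"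
  unfolding adapted_def
proof (intro allI impI)
  fix j assume "Suc j < length (map lessThan t)"
  then have j: "Suc j < length t" by simp
  have lt: "t ! j < t ! Suc j" using t j by (auto simp: size_vectors_def sorted_wrt_iff_nth_less)
  have "t ! Suc j \<in> set t" using j by simp
  then have le: "t ! Suc j \<le> n" using t by (auto simp: size_vectors_def)
  have e: "[0..<n] = [0..<t ! Suc j] @ [t ! Suc j..<n]"
    using le upt_add_eq_append[of 0 "t ! Suc j" "n - t ! Suc j"] by simp
  have "takeWhile (\<lambda>x. x < t ! Suc j) [0..<n] =
      [0..<t ! Suc j] @ takeWhile (\<lambda>x. x < t ! Suc j) [t ! Suc j..<n]"
    unfolding e by (rule takeWhile_append2) simp
  \<comment> \<open>The number \<open>t ! j\<close> lies outside \<open>{..<t ! j}\<close> and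
    inside \<open>{..<t ! Suc j}\<close>, so it witnesses adaptedness.\<close>
  then have "t ! j \<in> set (takeWhile (\<lambda>x. x < t ! Suc j) [0..<n])" using lt by simp
  then show "\<not> set (takeWhile (\<lambda>x. x \<in> map lessThan t ! Suc j) [0..<n]) \<subseteq> map lessThan t ! j"
    using j by auto
qed

lemma adapted_count_pos:
  assumes "t \<in> size_vectors n r"
  shows "adapted_count n (level_sequence (map lessThan t) [0..<n]) t > 0"
  unfolding adapted_count_def
  using adapted_upt[OF assms] upt_in_permutations by (subst card_gt_0_iff) auto

text \<open>In the word of \<open>t\<close>, the level after \<open>t ! j\<close> letters is at most
  \<open>j\<close>. An ordering with the same word relative to \<open>u\<close> therefore has its
  first \<open>t ! j\<close> entries in \<open>{..<u ! j}\<close>, and these are distinct.\<close>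

lemma adapted_count_triangular:
  assumes t: "t \<in> size_vectors n r" and u: "u \<in> size_vectors n r"
    and ne: "adapted_count n (level_sequence (map lessThan t) [0..<n]) u \<noteq> 0"
    and j: "j \<le> r"
  shows "t ! j \<le> u ! j"
proof -
  have len: "length t = Suc r" "length u = Suc r" using t u by (auto simp: size_vectors_def)
  have "t ! j \<in> set t" using j len by simp
  then have tn: "t ! j \<le> n" using t by (auto simp: size_vectors_def)
  obtain p where p: "p \<in> permutations_of_set {..<n}"
    and eq: "level_sequence (map lessThan u) p = level_sequence (map lessThan t) [0..<n]"
    using ne unfolding adapted_count_def by (metis (mono_tags, lifting) card.empty empty_Collect_eq)
  let ?A = "set (take (t ! j) p)"
  have "chain_level (map lessThan u) ?A = chain_level (map lessThan t) {..<t ! j}"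
    using level_sequence_eqD[OF eq, of "t ! j"] tn by (simp add: atLeast0LessThan)
  also have "\<dots> \<le> card {..<j}"
    unfolding chain_level_def
  proof (rule card_mono)
    show "{i. i < length (map lessThan t) \<and> \<not> {..<t ! j} \<subseteq> map lessThan t ! i} \<subseteq> {..<j}"
    proof
      fix i assume "i \<in> {i. i < length (map lessThan t) \<and> \<not> {..<t ! j} \<subseteq> map lessThan t ! i}"
      then have "i < length t" "t ! i < t ! j" by auto
      then show "i \<in> {..<j}"
        using t j len sorted_wrt_nth_less[of "(<)" t j i]
        by (cases i j rule: linorder_cases) (auto simp: size_vectors_def)
    qed
  qed simp
  finally have lev: "chain_level (map lessThan u) ?A \<le> j" by simp
  have "?A \<subseteq> {..<u ! j}"
  proof (rule ccontr)
    assume n: "\<not> ?A \<subseteq> {..<u ! j}"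
    \<comment> \<open>A set not contained in the member with index \<open>j\<close> of an increasing
      chain is contained in none of the members 0 to \<open>j\<close>, so its level is at least
      \<open>j + 1\<close>.\<close>
    have "card {..j} \<le> chain_level (map lessThan u) ?A"
      unfolding chain_level_def
    proof (rule card_mono)
      show "{..j} \<subseteq> {i. i < length (map lessThan u) \<and> \<not> ?A \<subseteq> map lessThan u ! i}"
      proof
        fix i assume i: "i \<in> {..j}"
        then have "u ! i \<le> u ! j"
          using u j len sorted_wrt_nth_less[of "(<)" u i j]
          by (cases "i = j") (auto simp: size_vectors_def)
        then have "\<not> ?A \<subseteq> {..<u ! i}" using n by fastforce
        then show "i \<in> {i. i < length (map lessThan u) \<and> \<not> ?A \<subseteq> map lessThan u ! i}"
          using i j len by simp
      qed
    qed simp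
    then show False using lev by simp
  qed
  then have "card ?A \<le> u ! j" using card_mono[of "{..<u ! j}" ?A] by simp
  moreover have "length p = n"
    using p length_finite_permutations_of_set by fastforce
  then have "card ?A = t ! j"
    using p tn distinct_card[of "take (t ! j) p"] by (simp add: permutations_of_setD)
  ultimately show ?thesis by simp
qed

context matroid
begin

lemma flag_subset_ground: "Xs \<in> flags M \<Longrightarrow> X \<in> set Xs \<Longrightarrow> X \<subseteq> ground M"
  using flag_nth(3) flag_length by (metis in_set_conv_nth less_Suc_eq_le)

lemma flag_sizes:
  assumes X: "Xs \<in> flags M"
  shows "map card Xs \<in> size_vectors (card (ground M)) (rank_of M)"
proof -
  have "set (map card Xs) \<subseteq> {..card (ground M)}"
    using flag_subset_ground[OF X] card_mono[OF finite_ground] by auto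
  moreover have "sorted_wrt (<) (map card Xs)"
    unfolding sorted_wrt_iff_nth_less
  proof (intro allI impI)
    fix i j assume ij: "i < j" "j < length (map card Xs)"
    then have j: "j \<le> rank_of M" using flag_length[OF X] by simp
    have "card (Xs ! i) < card (Xs ! j)"
      using flag_strict_mono[OF X ij(1) j] flag_nth(3)[OF X j] finite_ground
      by (blast intro: psubset_card_mono finite_subset)
    then show "map card Xs ! i < map card Xs ! j" using ij by simp
  qed
  ultimately show ?thesis by (simp add: size_vectors_def flag_length[OF X])
qed

lemma flag_bij:
  assumes X: "Xs \<in> flags M"
  obtains q where "bij_betw q {..<card (ground M)} (ground M)"
    "\<And>X. X \<in> set Xs \<Longrightarrow> q ` {..<card X} = X \<and> card X \<le> card (ground M)"
proof -
  have "sorted_wrt (\<subset>) Xs" using X by (simp add: flags_def flat_chains_def)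
  from chain_bij[OF finite_ground this] show ?thesis
    using that flag_subset_ground[OF X] card_mono[OF finite_ground] by (metis (lifting))
qed

text \<open>After splitting by flags, each class is transported to \<open>{..<n}\<close>. The
  coefficient of \<open>w\<close> in the G-invariant thus depends only on the sizes of the
  flags.\<close>

lemma card_rank_sequence:
  "card {p \<in> permutations_of_set (ground M). rank_sequence M p = w} =
    (\<Sum>Xs \<in> flags M. adapted_count (card (ground M)) w (map card Xs))"
proof -
  have "card {p \<in> permutations_of_set (ground M). rank_sequence M p = w} =
    (\<Sum>Xs \<in> flags M. card {p \<in> permutations_of_set (ground M). adapted Xs p \<and> level_sequence Xs p = w})"
    by (rule card_permutations_by_flag) (simp add: rank_sequence_adapted)
  also have "\<dots> = (\<Sum>Xs \<in> flags M. adapted_count (card (ground M)) w (map card Xs))"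
  proof (rule sum.cong[OF refl])
    fix Xs assume X: "Xs \<in> flags M"
    let ?n = "card (ground M)"
    obtain q where q: "bij_betw q {..<?n} (ground M)"
      "\<And>X. X \<in> set Xs \<Longrightarrow> q ` {..<card X} = X \<and> card X \<le> ?n" using flag_bij[OF X] by blast
    have inj: "inj_on q {..<?n}" using q(1) by (simp add: bij_betw_def)
    have "card {p \<in> permutations_of_set (ground M). adapted Xs p \<and> level_sequence Xs p = w} =
        card {p \<in> permutations_of_set {..<?n}. adapted Xs (map q p) \<and> level_sequence Xs (map q p) = w}"
      by (rule card_permutations_bij[OF q(1)])
    also have "\<dots> = adapted_count ?n w (map card Xs)"
      unfolding adapted_count_def
      using adapted_map_iff[OF inj q(2)] level_sequence_map[OF inj q(2)]
      by (intro arg_cong[of _ _ card] Collect_cong) (auto simp: permutations_of_set_def)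
    finally show "card {p \<in> permutations_of_set (ground M). adapted Xs p \<and> level_sequence Xs p = w} =
      adapted_count ?n w (map card Xs)" .
  qed
  finally show ?thesis .
qed

lemma sum_flags_by_sizes:
  "(\<Sum>Xs \<in> flags M. g (map card Xs)) =
    (\<Sum>t \<in> size_vectors (card (ground M)) (rank_of M). flag_size_count M t * g t)"
proof -
  have "(\<Sum>Xs \<in> flags M. g (map card Xs)) =
      (\<Sum>t \<in> size_vectors (card (ground M)) (rank_of M). \<Sum>Xs \<in> {Xs \<in> flags M. map card Xs = t}. g (map card Xs))"
    by (rule sum.group[symmetric]) (use finite_flags finite_size_vectors flag_sizes in auto)
  also have "\<dots> = (\<Sum>t \<in> size_vectors (card (ground M)) (rank_of M). flag_size_count M t * g t)"
    by (intro sum.cong) (simp_all add: flag_size_count_def)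
  finally show ?thesis .
qed

lemma flag_size_count_outside:
  "t \<notin> size_vectors (card (ground M)) (rank_of M) \<Longrightarrow> flag_size_count M t = 0"
  unfolding flag_size_count_def using flag_sizes by (metis (mono_tags, lifting) card.empty empty_Collect_eq)

end

lemma lookup_G_inv:
  "Poly_Mapping.lookup (G_inv M :: nat list \<Rightarrow>\<^sub>0 'k::field_char_0) w =
    of_nat (card {p \<in> permutations_of_set (ground M). rank_sequence M p = w})"
  unfolding G_inv_def lookup_sum
  by (simp add: lookup_single when_def sum.If_cases Int_def)

text \<open>Characteristic zero makes \<open>of_nat\<close> injective, so the coefficients can be
  compared as natural numbers.\<close>

lemma G_inv_eq_iff:
  "(G_inv M :: nat list \<Rightarrow>\<^sub>0 'k::field_char_0) = G_inv M1 \<longleftrightarrow>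
    (\<forall>w. card {p \<in> permutations_of_set (ground M). rank_sequence M p = w} =
         card {p \<in> permutations_of_set (ground M1). rank_sequence M1 p = w})"
  by (simp add: poly_mapping_eq_iff fun_eq_iff lookup_G_inv)

text \<open>Some ordering of the ground set of \<open>M\<close> exists, and its word has a nonzero
  coefficient in both invariants. The length and the sum of this word are the size and the
  rank.\<close>

lemma G_inv_eq_size_rank:
  assumes "matroid M" "matroid M1" and eq: "(G_inv M1 :: nat list \<Rightarrow>\<^sub>0 'k::field_char_0) = G_inv M"
  shows "card (ground M1) = card (ground M) \<and> rank_of M1 = rank_of M"
proof -
  interpret M: matroid M by fact
  interpret M1: matroid M1 by fact
  obtain p where p: "p \<in> permutations_of_set (ground M)"
    using M.finite_ground permutations_of_set_empty_iff by fastforce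
  let ?w = "rank_sequence M p"
  have "card {p \<in> permutations_of_set (ground M). rank_sequence M p = ?w} \<noteq> 0"
    using p by auto
  then have "card {p \<in> permutations_of_set (ground M1). rank_sequence M1 p = ?w} \<noteq> 0"
    using eq by (simp add: G_inv_eq_iff)
  then obtain p1 where "p1 \<in> permutations_of_set (ground M1)" "rank_sequence M1 p1 = ?w"
    by (metis (mono_tags, lifting) card.empty empty_Collect_eq)
  then have "?w \<in> rank_words (card (ground M1)) (rank_of M1)"
    using M1.rank_sequence_in_rank_words by metis
  moreover have "?w \<in> rank_words (card (ground M)) (rank_of M)"
    using M.rank_sequence_in_rank_words[OF p] .
  ultimately show ?thesis by (simp add: rank_words_def)
qed

lemma G_inv_eqI:
  assumes "matroid M" "matroid M1" "card (ground M1) = card (ground M)" "rank_of M1 = rank_of M"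
    and "\<And>t. flag_size_count M1 t = flag_size_count M t"
  shows "(G_inv M1 :: nat list \<Rightarrow>\<^sub>0 'k::field_char_0) = G_inv M"
  unfolding G_inv_eq_iff matroid.card_rank_sequence[OF assms(1)] matroid.card_rank_sequence[OF assms(2)]
    matroid.sum_flags_by_sizes[OF assms(1)] matroid.sum_flags_by_sizes[OF assms(2)]
  by (simp add: assms(3-5))

text \<open>Triangular inversion. Among the vectors with different counts, choose \<open>t\<close>
  with the largest entry sum and compare coefficients at its word. Every other contributing
  \<open>u\<close> dominates \<open>t\<close> pointwise, so it has a larger sum and equal counts.
  Only the term of \<open>t\<close> is left, and its factor is positive.\<close>

lemma flag_size_count_eq_of_G_inv:
  assumes M: "matroid M" and M1: "matroid M1"
    and eq: "(G_inv M1 :: nat list \<Rightarrow>\<^sub>0 'k::field_char_0) = G_inv M"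
  shows "flag_size_count M1 t = flag_size_count M t"
proof (rule ccontr)
  let ?n = "card (ground M)" and ?r = "rank_of M"
  have same: "card (ground M1) = ?n" "rank_of M1 = ?r"
    using G_inv_eq_size_rank[OF M M1 eq] by auto
  let ?D = "{t \<in> size_vectors ?n ?r. flag_size_count M1 t \<noteq> flag_size_count M t}"
  assume "flag_size_count M1 t \<noteq> flag_size_count M t"
  then have "t \<in> ?D"
    using matroid.flag_size_count_outside[OF M, of t] matroid.flag_size_count_outside[OF M1, of t] same
    by (cases "t \<in> size_vectors ?n ?r") simp_all
  then have ne: "?D \<noteq> {}" by blast
  have fin: "finite ?D" using finite_size_vectors by simp
  obtain t where tD: "t \<in> ?D" and tmax: "Max (sum_list ` ?D) = sum_list t"
    by (rule obtains_MAX[OF fin ne])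
  have max: "sum_list u \<le> sum_list t" if "u \<in> ?D" for u
    unfolding tmax[symmetric] using fin that by (intro Max_ge finite_imageI imageI)
  from tD have t: "t \<in> size_vectors ?n ?r" by simp
  let ?w = "level_sequence (map lessThan t) [0..<?n]"
  have "(\<Sum>u \<in> size_vectors ?n ?r. flag_size_count M1 u * adapted_count ?n ?w u) =
      (\<Sum>u \<in> size_vectors ?n ?r. flag_size_count M u * adapted_count ?n ?w u)"
    using eq unfolding G_inv_eq_iff matroid.card_rank_sequence[OF M] matroid.card_rank_sequence[OF M1]
      matroid.sum_flags_by_sizes[OF M] matroid.sum_flags_by_sizes[OF M1] same by blast
  moreover have "flag_size_count M1 u * adapted_count ?n ?w u = flag_size_count M u * adapted_count ?n ?w u"
    if u: "u \<in> size_vectors ?n ?r - {t}" for u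
  proof (cases "adapted_count ?n ?w u = 0")
    case False
    have len: "length t = Suc ?r" "length u = Suc ?r" using t u by (auto simp: size_vectors_def)
    have le: "t ! j \<le> u ! j" if "j < Suc ?r" for j
      using adapted_count_triangular[OF t _ False] u that by simp
    obtain j where j: "j < Suc ?r" "t ! j \<noteq> u ! j"
      using u len by (metis DiffD2 insertI1 nth_equalityI)
    then have "t ! j < u ! j" using le[of j] by simp
    then have "\<exists>i \<in> {0..<Suc ?r}. t ! i < u ! i" using j(1) by (meson atLeastLessThan_iff zero_le)
    moreover have "\<forall>i \<in> {0..<Suc ?r}. t ! i \<le> u ! i" using le by (meson atLeastLessThan_iff)
    ultimately have "sum ((!) t) {0..<Suc ?r} < sum ((!) u) {0..<Suc ?r}"
      by (intro sum_strict_mono_ex1) (rule finite_atLeastLessThan)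
    then have "sum_list t < sum_list u"
      unfolding sum_list_sum_nth len .
    then have "u \<notin> ?D" using max by fastforce
    then show ?thesis using u by simp
  qed simp
  ultimately have "flag_size_count M1 t * adapted_count ?n ?w t = flag_size_count M t * adapted_count ?n ?w t"
    using t finite_size_vectors[of ?n ?r]
    by (simp add: sum.remove[of "size_vectors ?n ?r" t])
  then show False using adapted_count_pos[OF t] tD by simp
qed

section \<open>Counting chains of flats\<close>

definition prefix_sets :: "nat list \<Rightarrow> 'a list \<Rightarrow> 'a set list" where
  "prefix_sets s p = map (\<lambda>m. set (take m p)) s"

text \<open>The term \<open>take (k - h + 1) (drop h t)\<close> is the slice
  \<open>t_h, ..., t_k\<close>, standing for the flats of ranks \<open>h\<close> to \<open>k\<close>
  of a flag.\<close>

definition prefix_count :: "nat \<Rightarrow> nat \<Rightarrow> nat \<Rightarrow> nat list \<Rightarrow> nat list \<Rightarrow> nat" where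
  "prefix_count n h k s t = card {p \<in> permutations_of_set {..<n}.
     adapted (map lessThan t) p \<and>
     prefix_sets s p = map lessThan (take (k - h + 1) (drop h t))}"

lemma prefix_sets_map_eq_iff:
  assumes inj: "inj_on q {..<n}"
    and Zs: "\<And>Z. Z \<in> set Zs \<Longrightarrow> q ` {..<card Z} = Z \<and> card Z \<le> n"
    and p: "set p \<subseteq> {..<n}"
  shows "prefix_sets s (map q p) = Zs \<longleftrightarrow> prefix_sets s p = map (lessThan \<circ> card) Zs"
proof -
  have "q ` set (take m p) = Z \<longleftrightarrow> set (take m p) = {..<card Z}" if "Z \<in> set Zs" for Z m
  proof -
    have "set (take m p) \<subseteq> {..<n}" using p set_take_subset by fast
    moreover have "{..<card Z} \<subseteq> {..<n}" using Zs[OF that] by auto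
    ultimately have "q ` set (take m p) = q ` {..<card Z} \<longleftrightarrow> set (take m p) = {..<card Z}"
      by (rule inj_on_image_eq_iff[OF inj])
    then show ?thesis using Zs[OF that] by simp
  qed
  then show ?thesis
    by (simp add: prefix_sets_def list_eq_iff_nth_eq take_map cong: conj_cong)
qed

context matroid
begin

lemma flat_chain_subset_ground:
  assumes "Ys \<in> flat_chains M h k" "Y \<in> set Ys"
  shows "Y \<subseteq> ground M"
proof -
  obtain i where "i < length Ys" "Y = Ys ! i" using assms(2) by (metis in_set_conv_nth)
  then show ?thesis using assms(1) by (simp add: flat_chains_def flat_def)
qed

lemma finite_flat_chains: "finite (flat_chains M h k)"
proof (rule finite_subset)
  show "flat_chains M h k \<subseteq> {Xs. set Xs \<subseteq> Pow (ground M) \<and> length Xs = k - h + 1}"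
  proof
    fix Xs assume X: "Xs \<in> flat_chains M h k"
    then have "set Xs \<subseteq> Pow (ground M)" using flat_chain_subset_ground by blast
    moreover have "length Xs = k - h + 1" using X by (simp add: flat_chains_def)
    ultimately show "Xs \<in> {Xs. set Xs \<subseteq> Pow (ground M) \<and> length Xs = k - h + 1}" by simp
  qed
  show "finite {Xs. set Xs \<subseteq> Pow (ground M) \<and> length Xs = k - h + 1}"
    using finite_ground by (intro finite_lists_length_eq) simp
qed

text \<open>An initial segment that is a flat of rank \<open>j\<close> must be the flat of rank
  \<open>j\<close> in the flag of \<open>p\<close>. Hence a chain of flats among the initial
  segments is a slice of that flag.\<close>

lemma adapted_prefix_sets_iff:
  assumes X: "Xs \<in> flags M" and p: "p \<in> permutations_of_set (ground M)" and ad: "adapted Xs p"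
    and hk: "h \<le> k" "k \<le> rank_of M" and len: "length s = k - h + 1"
  shows "prefix_sets s p \<in> flat_chains M h k \<longleftrightarrow> prefix_sets s p = take (k - h + 1) (drop h Xs)"
proof
  assume F: "prefix_sets s p \<in> flat_chains M h k"
  show "prefix_sets s p = take (k - h + 1) (drop h Xs)"
  proof (rule nth_equalityI)
    show "length (prefix_sets s p) = length (take (k - h + 1) (drop h Xs))"
      using hk len flag_length[OF X] by (simp add: prefix_sets_def)
    fix i assume "i < length (prefix_sets s p)"
    then have i: "i < length s" "i \<le> k - h" using len by (auto simp: prefix_sets_def)
    then have "flat M (set (take (s ! i) p))" "rk M (set (take (s ! i) p)) = h + i"
      using F by (auto simp: flat_chains_def prefix_sets_def)
    then have "set (take (s ! i) p) = Xs ! (h + i)"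
      using hk i by (intro adapted_flat_eq[OF X p ad]) auto
    then show "prefix_sets s p ! i = take (k - h + 1) (drop h Xs) ! i"
      using i hk flag_length[OF X] by (simp add: prefix_sets_def)
  qed
next
  have "sorted_wrt (\<subset>) Xs" using X by (simp add: flags_def flat_chains_def)
  then have "take (k - h + 1) (drop h Xs) \<in> flat_chains M h k"
    using hk flag_length[OF X] flag_nth(1,2)[OF X]
    by (auto simp: flat_chains_def intro!: sorted_wrt_take sorted_wrt_drop)
  then show "prefix_sets s p \<in> flat_chains M h k"
    if "prefix_sets s p = take (k - h + 1) (drop h Xs)" using that by simp
qed

text \<open>The first of two counts of the same orderings; here the matroid enters only through the
  sizes of its flags.\<close>

lemma card_prefix_chains_by_flag:
  assumes hk: "h \<le> k" "k \<le> rank_of M" and len: "length s = k - h + 1"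
  shows "card {p \<in> permutations_of_set (ground M). prefix_sets s p \<in> flat_chains M h k} =
    (\<Sum>Xs \<in> flags M. prefix_count (card (ground M)) h k s (map card Xs))"
proof -
  have "card {p \<in> permutations_of_set (ground M). prefix_sets s p \<in> flat_chains M h k} =
    (\<Sum>Xs \<in> flags M. card {p \<in> permutations_of_set (ground M).
       adapted Xs p \<and> prefix_sets s p = take (k - h + 1) (drop h Xs)})"
    by (rule card_permutations_by_flag) (simp add: adapted_prefix_sets_iff[OF _ _ _ hk len])
  also have "\<dots> = (\<Sum>Xs \<in> flags M. prefix_count (card (ground M)) h k s (map card Xs))"
  proof (rule sum.cong[OF refl])
    fix Xs assume X: "Xs \<in> flags M"
    let ?n = "card (ground M)" and ?Z = "take (k - h + 1) (drop h Xs)"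
    obtain q where q: "bij_betw q {..<?n} (ground M)"
      "\<And>X. X \<in> set Xs \<Longrightarrow> q ` {..<card X} = X \<and> card X \<le> ?n" using flag_bij[OF X] by blast
    have inj: "inj_on q {..<?n}" using q(1) by (simp add: bij_betw_def)
    have Z: "q ` {..<card Z} = Z \<and> card Z \<le> ?n" if "Z \<in> set ?Z" for Z
      using that by (intro q(2)) (meson in_set_dropD in_set_takeD)
    have "card {p \<in> permutations_of_set (ground M). adapted Xs p \<and> prefix_sets s p = ?Z} =
        card {p \<in> permutations_of_set {..<?n}. adapted Xs (map q p) \<and> prefix_sets s (map q p) = ?Z}"
      by (rule card_permutations_bij[OF q(1)])
    also have "\<dots> = prefix_count ?n h k s (map card Xs)"
      unfolding prefix_count_def
    proof (intro arg_cong[of _ _ card] Collect_cong conj_cong refl)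
      fix p assume "p \<in> permutations_of_set {..<?n}"
      then have p: "set p \<subseteq> {..<?n}" by (simp add: permutations_of_setD(1))
      show "adapted Xs (map q p) \<longleftrightarrow> adapted (map lessThan (map card Xs)) p"
        using adapted_map_iff[OF inj q(2) p] by simp
      show "prefix_sets s (map q p) = ?Z \<longleftrightarrow>
          prefix_sets s p = map lessThan (take (k - h + 1) (drop h (map card Xs)))"
        using prefix_sets_map_eq_iff[OF inj Z p, of ?Z s] by (simp add: take_map drop_map)
    qed
    finally show "card {p \<in> permutations_of_set (ground M). adapted Xs p \<and> prefix_sets s p = ?Z} =
      prefix_count ?n h k s (map card Xs)" .
  qed
  finally show ?thesis .
qed

text \<open>The second count, by the chain found among the initial segments. Each chain with sizes
  \<open>s\<close> arises from equally many orderings, because a bijection moves it to initial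
  segments of \<open>{..<n}\<close>.\<close>

lemma card_prefix_chains:
  assumes s: "set s \<subseteq> {..card (ground M)}"
  shows "card {p \<in> permutations_of_set (ground M). prefix_sets s p \<in> flat_chains M h k} =
    F_num M h k s *
    card {p \<in> permutations_of_set {..<card (ground M)}. prefix_sets s p = map lessThan s}"
proof -
  let ?n = "card (ground M)" and ?C = "{Ys \<in> flat_chains M h k. map card Ys = s}"
  have cards: "map card (prefix_sets s p) = s" if "p \<in> permutations_of_set (ground M)" for p
  proof -
    have "distinct p" "length p = ?n"
      using that length_finite_permutations_of_set permutations_of_setD(2) by auto
    \<comment> \<open>The bound on \<open>s\<close> keeps \<open>take m p\<close> from being cut
      short by the end of \<open>p\<close>.\<close>
    then have "card (set (take m p)) = m" if "m \<in> set s" for m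
      using s that distinct_card[of "take m p"] by auto
    then show ?thesis by (simp add: prefix_sets_def map_idI)
  qed
  have "{p \<in> permutations_of_set (ground M). prefix_sets s p \<in> flat_chains M h k} =
      (\<Union>Ys \<in> ?C. {p \<in> permutations_of_set (ground M). prefix_sets s p = Ys})"
    using cards by auto
  also have "card \<dots> = (\<Sum>Ys \<in> ?C. card {p \<in> permutations_of_set (ground M). prefix_sets s p = Ys})"
    by (intro card_UN_disjoint) (auto simp: finite_flat_chains)
  also have "\<dots> = (\<Sum>Ys \<in> ?C. card {p \<in> permutations_of_set {..<?n}. prefix_sets s p = map lessThan s})"
  proof (rule sum.cong[OF refl])
    fix Ys assume "Ys \<in> ?C"
    then have Y: "Ys \<in> flat_chains M h k" "map card Ys = s" by auto
    have sub: "\<forall>Y \<in> set Ys. Y \<subseteq> ground M" using flat_chain_subset_ground[OF Y(1)] by blast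
    have "sorted_wrt (\<subset>) Ys" using Y(1) by (simp add: flat_chains_def)
    from chain_bij[OF finite_ground this sub] obtain q where
      q: "bij_betw q {..<?n} (ground M)" "\<forall>Y \<in> set Ys. q ` {..<card Y} = Y" by blast
    have inj: "inj_on q {..<?n}" using q(1) by (simp add: bij_betw_def)
    have Z: "q ` {..<card Y} = Y \<and> card Y \<le> ?n" if "Y \<in> set Ys" for Y
      using bspec[OF q(2) that] card_mono[OF finite_ground bspec[OF sub that]] by (rule conjI)
    have "card {p \<in> permutations_of_set (ground M). prefix_sets s p = Ys} =
        card {p \<in> permutations_of_set {..<?n}. prefix_sets s (map q p) = Ys}"
      by (rule card_permutations_bij[OF q(1)])
    also have "\<dots> = card {p \<in> permutations_of_set {..<?n}. prefix_sets s p = map lessThan s}"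
    proof (intro arg_cong[of _ _ card] Collect_cong conj_cong refl)
      fix p assume "p \<in> permutations_of_set {..<?n}"
      then have p: "set p \<subseteq> {..<?n}" by (simp add: permutations_of_setD(1))
      have "map (lessThan \<circ> card) Ys = map lessThan s" using Y(2) by auto
      then show "prefix_sets s (map q p) = Ys \<longleftrightarrow> prefix_sets s p = map lessThan s"
        using prefix_sets_map_eq_iff[OF inj Z p, of Ys s] by simp
    qed
    finally show "card {p \<in> permutations_of_set (ground M). prefix_sets s p = Ys} =
      card {p \<in> permutations_of_set {..<?n}. prefix_sets s p = map lessThan s}" .
  qed
  also have "\<dots> = F_num M h k s *
      card {p \<in> permutations_of_set {..<?n}. prefix_sets s p = map lessThan s}"
    by (simp add: F_num_def)
  finally show ?thesis .
qed

text \<open>The implication in the hypothesis covers two cases: a wrong length, where it holds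
  vacuously, and an entry exceeding the size of the ground set.\<close>

lemma F_num_eq_0:
  assumes "length s = k - h + 1 \<Longrightarrow> \<not> set s \<subseteq> {..card (ground M)}"
  shows "F_num M h k s = 0"
proof -
  have "False" if Y: "Ys \<in> flat_chains M h k" "map card Ys = s" for Ys
  proof -
    have "length s = k - h + 1" using Y by (auto simp: flat_chains_def)
    moreover have "set s \<subseteq> {..card (ground M)}"
      using Y(2) flat_chain_subset_ground[OF Y(1)] card_mono[OF finite_ground] by auto
    ultimately show False using assms by simp
  qed
  then have "{Ys \<in> flat_chains M h k. map card Ys = s} = {}" by blast
  then show ?thesis unfolding F_num_def by (simp only: card.empty)
qed

end

text \<open>The count by flags gives the same total for both matroids; the count by chains writes
  each total as \<open>F_num\<close> times a common positive factor, which cancels.\<close>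

lemma F_num_eq:
  assumes M: "matroid M" and M1: "matroid M1"
    and n: "card (ground M1) = card (ground M)" and r: "rank_of M1 = rank_of M"
    and eq: "\<And>t. flag_size_count M1 t = flag_size_count M t"
    and hk: "h \<le> k" "k \<le> rank_of M"
  shows "F_num M1 h k s = F_num M h k s"
proof (cases "length s = k - h + 1 \<and> set s \<subseteq> {..card (ground M)}")
  case True
  then have len: "length s = k - h + 1" and s: "set s \<subseteq> {..card (ground M)}"
    and s1: "set s \<subseteq> {..card (ground M1)}" using n by auto
  have hk1: "k \<le> rank_of M1" using hk r by simp
  let ?C = "{p \<in> permutations_of_set {..<card (ground M)}. prefix_sets s p = map lessThan s}"
  have "F_num M1 h k s * card ?C =
      card {p \<in> permutations_of_set (ground M1). prefix_sets s p \<in> flat_chains M1 h k}"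
    using matroid.card_prefix_chains[OF M1 s1, of h k] unfolding n by (rule sym)
  also have "\<dots> = card {p \<in> permutations_of_set (ground M). prefix_sets s p \<in> flat_chains M h k}"
    unfolding matroid.card_prefix_chains_by_flag[OF M hk len]
      matroid.card_prefix_chains_by_flag[OF M1 hk(1) hk1 len]
      matroid.sum_flags_by_sizes[OF M] matroid.sum_flags_by_sizes[OF M1] n r eq by (rule refl)
  also have "\<dots> = F_num M h k s * card ?C"
    by (rule matroid.card_prefix_chains[OF M s])
  finally have "F_num M1 h k s * card ?C = F_num M h k s * card ?C" .
  \<comment> \<open>The identity ordering realises every such \<open>s\<close>, so the common factor
    is not zero.\<close>
  moreover have "[0..<card (ground M)] \<in> ?C"
    using s upt_in_permutations by (auto simp: prefix_sets_def)
  then have "card ?C \<noteq> 0" by (subst card_0_eq) auto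
  ultimately show ?thesis by simp
next
  case False
  then show ?thesis
    using matroid.F_num_eq_0[OF M, of s k h] matroid.F_num_eq_0[OF M1, of s k h] n by auto
qed

section \<open>Compositions and size vectors of flags\<close>

definition size_differences :: "nat list \<Rightarrow> nat list" where
  "size_differences t = map (\<lambda>j. if j = 0 then t ! 0 else t ! j - t ! (j - 1)) [0..<length t]"

lemma size_differences_inj:
  assumes "t \<in> size_vectors n r" "u \<in> size_vectors n r" "size_differences t = size_differences u"
  shows "t = u"
proof (rule nth_equalityI)
  have len: "length t = Suc r" "length u = Suc r" using assms(1,2) by (auto simp: size_vectors_def)
  then show "length t = length u" by simp
  show "t ! j = u ! j" if "j < length t" for j
    using that
  proof (induction j)
    case 0
    have "size_differences t ! 0 = size_differences u ! 0" using assms(3) by simp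
    then show ?case by (simp add: size_differences_def len nth_append del: upt_Suc)
  next
    case (Suc j)
    have "size_differences t ! Suc j = size_differences u ! Suc j" using assms(3) by simp
    then have "t ! Suc j - t ! j = u ! Suc j - u ! j"
      using Suc.prems len by (simp add: size_differences_def del: upt_Suc)
    moreover have "t ! j < t ! Suc j" "u ! j < u ! Suc j"
      using assms(1,2) Suc.prems len by (simp_all add: size_vectors_def sorted_wrt_nth_less)
    ultimately show ?case using Suc by simp
  qed
qed

context matroid
begin

lemma flag_composition_eq:
  assumes X: "Xs \<in> flags M"
  shows "flag_composition Xs = size_differences (map card Xs)"
proof -
  have "card (Xs ! j - Xs ! (j - 1)) = card (Xs ! j) - card (Xs ! (j - 1))"
    if "j < length Xs" for j
  proof (rule card_Diff_subset)
    have j: "j \<le> rank_of M" using that flag_length[OF X] by simp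
    show "Xs ! (j - 1) \<subseteq> Xs ! j" using flag_mono[OF X _ j] by simp
    show "finite (Xs ! (j - 1))"
      using flag_nth(3)[OF X, of "j - 1"] j finite_subset[OF _ finite_ground] by simp
  qed
  moreover have "length Xs > 0" using flag_length[OF X] by simp
  ultimately show ?thesis
    by (auto simp: flag_composition_def size_differences_def)
qed

text \<open>The differences telescope to the size of the last member, the ground set. It follows in
  \<open>nu_eq_0\<close> that the index set of the catenary data misses no flag.\<close>

lemma flag_composition_in_compositions:
  assumes X: "Xs \<in> flags M"
  shows "flag_composition Xs \<in> compositions (card (ground M)) (rank_of M)"
proof -
  define t where "t = map card Xs"
  have len: "length t = Suc (rank_of M)" using flag_length[OF X] by (simp add: t_def)
  have lt: "t ! j < t ! Suc j" if "Suc j < length t" for j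
    using flag_sizes[OF X] that sorted_wrt_nth_less[of "(<)" t j "Suc j"]
    by (simp add: size_vectors_def t_def)
  let ?d = "\<lambda>j. if j = 0 then t ! 0 else t ! j - t ! (j - 1)"
  have "sum ?d {0..<Suc m} = t ! m" if "m < length t" for m
    using that
  proof (induction m)
    case (Suc m)
    then show ?case using lt[of m] by simp
  qed simp
  then have "sum ?d {0..<length t} = t ! rank_of M" using len by simp
  moreover have "sum_list (size_differences t) = sum ?d {0..<length t}"
    by (simp add: size_differences_def interv_sum_list_conv_sum_set_nat)
  ultimately have "sum_list (size_differences t) = t ! rank_of M" by simp
  also have "\<dots> = card (ground M)"
    using flag_last[OF X] flag_length[OF X] by (simp add: t_def)
  finally have "sum_list (size_differences t) = card (ground M)" .
  moreover have "size_differences t ! j > 0" if "j \<in> {1..rank_of M}" for j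
    using that len lt[of "j - 1"] by (simp add: size_differences_def del: upt_Suc)
  ultimately show ?thesis
    using len by (simp add: compositions_def flag_composition_eq[OF X] t_def[symmetric])
      (simp add: size_differences_def)
qed

lemma flag_size_count_eq_nu:
  assumes t: "t \<in> size_vectors (card (ground M)) (rank_of M)"
  shows "flag_size_count M t = nu M (size_differences t)"
proof -
  have "map card Xs = t \<longleftrightarrow> flag_composition Xs = size_differences t" if "Xs \<in> flags M" for Xs
    using flag_composition_eq[OF that] size_differences_inj[OF flag_sizes[OF that] t] by auto
  then have "{Xs \<in> flags M. map card Xs = t} = {Xs \<in> flags M. flag_composition Xs = size_differences t}"
    by blast
  then show ?thesis by (simp add: flag_size_count_def nu_def)
qed

lemma nu_eq_0: "a \<notin> compositions (card (ground M)) (rank_of M) \<Longrightarrow> nu M a = 0"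
  unfolding nu_def using flag_composition_in_compositions
  by (metis (mono_tags, lifting) card.empty empty_Collect_eq)

end

text \<open>The restricted functions compare \<open>nu\<close> only on compositions, but off them
  both values are 0. Likewise both flag counts are 0 off \<open>size_vectors\<close>.\<close>

lemma flag_size_count_eq_of_catenary_data:
  assumes M: "matroid M" and M1: "matroid M1"
    and n: "card (ground M1) = card (ground M)" and r: "rank_of M1 = rank_of M"
    and eq: "catenary_data M1 = catenary_data M"
  shows "flag_size_count M1 t = flag_size_count M t"
proof -
  have "nu M1 a = nu M a" for a
  proof (cases "a \<in> compositions (card (ground M)) (rank_of M)")
    case True
    then show ?thesis using fun_cong[OF eq, of a] n r by (simp add: catenary_data_def)
  next
    case False
    then show ?thesis using matroid.nu_eq_0[OF M] matroid.nu_eq_0[OF M1] n r by simp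
  qed
  then show ?thesis
    using matroid.flag_size_count_eq_nu[OF M, of t] matroid.flag_size_count_eq_nu[OF M1, of t]
      matroid.flag_size_count_outside[OF M, of t] matroid.flag_size_count_outside[OF M1, of t] n r
    by (cases "t \<in> size_vectors (card (ground M)) (rank_of M)") simp_all
qed

section \<open>Flags of minors at a flat\<close>

context matroid
begin

lemma flat_rank_eq:
  assumes "flat M X" "flat M Y" "X \<subseteq> Y" "rk M X = rk M Y"
  shows "X = Y"
  using closure_of_eq_flat[OF assms(2-4)] closure_of_flat[OF assms(1)] by simp

lemma flat_ground: "flat M (ground M)"
  by (simp add: flat_def)

lemma flat_chain_nth:
  assumes "Xs \<in> flat_chains M h k" "i \<le> k - h"
  shows "flat M (Xs ! i)" "rk M (Xs ! i) = h + i"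
  using assms by (simp_all add: flat_chains_def)

lemma flat_chain_mono:
  assumes "Xs \<in> flat_chains M h k" "i \<le> j" "j \<le> k - h"
  shows "Xs ! i \<subseteq> Xs ! j"
proof (cases "i = j")
  case False
  have "sorted_wrt (\<subset>) Xs" "j < length Xs" using assms by (simp_all add: flat_chains_def)
  then have "Xs ! i \<subset> Xs ! j" using False assms(2) by (intro sorted_wrt_nth_less[of "(\<subset>)" Xs]) auto
  then show ?thesis by blast
qed simp

lemma flat_chain_last:
  assumes "Xs \<in> flat_chains M h k"
  shows "last Xs = Xs ! (k - h)"
proof -
  have "length Xs = k - h + 1" using assms by (simp add: flat_chains_def)
  then show ?thesis by (subst last_conv_nth) auto
qed

text \<open>Only an element outside \<open>F\<close> could keep a flat \<open>X\<close> of
  \<open>M|F\<close> from being a flat of \<open>M\<close>, and the closure of \<open>X\<close>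
  stays inside the closure of \<open>F\<close>, which is \<open>F\<close>.\<close>

lemma flat_restriction_iff:
  assumes F: "flat M F"
  shows "flat (restriction M F) X \<longleftrightarrow> flat M X \<and> X \<subseteq> F"
proof
  assume X: "flat (restriction M F) X"
  then have XF: "X \<subseteq> F" by (simp add: flat_def restriction_def)
  then have XE: "X \<subseteq> ground M" using F by (auto simp: flat_def)
  have "rk M X < rk M (insert x X)" if x: "x \<in> ground M - X" for x
  proof (cases "x \<in> F")
    case True
    then show ?thesis using X x by (simp add: flat_def restriction_def)
  next
    case False
    then have "x \<notin> closure_of X"
      using closure_of_mono[of X F] XF F closure_of_flat[OF F] by (auto simp: flat_def)
    then have "rk M (insert x X) \<noteq> rk M X" using x by (simp add: closure_of_def)
    moreover have "rk M X \<le> rk M (insert x X)" using x XE by (intro rk_mono) auto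
    ultimately show ?thesis by simp
  qed
  then show "flat M X \<and> X \<subseteq> F" using XF XE by (simp add: flat_def)
next
  assume "flat M X \<and> X \<subseteq> F"
  then show "flat (restriction M F) X"
    using F unfolding flat_def restriction_def by (simp add: subset_iff)
qed

lemma flags_restriction:
  assumes F: "flat M F"
  shows "flags (restriction M F) = {Xs \<in> flat_chains M 0 (rk M F). last Xs = F}"
proof -
  have "rank_of (restriction M F) = rk M F" "ground (restriction M F) = F"
    by (simp_all add: rank_of_def restriction_def)
  then have "Xs \<in> flags (restriction M F) \<longleftrightarrow>
      Xs \<in> flat_chains (restriction M F) 0 (rk M F) \<and> last Xs = F" for Xs
    by (simp add: flags_def)
  moreover have "Xs \<in> flat_chains (restriction M F) 0 (rk M F) \<longleftrightarrow> Xs \<in> flat_chains M 0 (rk M F)"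
    if last: "last Xs = F" for Xs
  proof
    assume "Xs \<in> flat_chains (restriction M F) 0 (rk M F)"
    then show "Xs \<in> flat_chains M 0 (rk M F)"
      by (simp add: flat_chains_def flat_restriction_iff[OF F]) (simp add: restriction_def)
  next
    assume X: "Xs \<in> flat_chains M 0 (rk M F)"
    have "Xs ! i \<subseteq> F" if "i \<le> rk M F" for i
      using flat_chain_mono[OF X that] flat_chain_last[OF X] last by simp
    then show "Xs \<in> flat_chains (restriction M F) 0 (rk M F)"
      using X by (simp add: flat_chains_def flat_restriction_iff[OF F]) (simp add: restriction_def)
  qed
  ultimately show ?thesis by blast
qed

text \<open>Since \<open>F\<close> is the only flat of its rank and size, a chain ends in
  \<open>F\<close> exactly when its last size is \<open>s\<close>.\<close>

lemma flag_size_count_restriction: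
  assumes u: "flats_rank_size M k s = {F}"
  shows "flag_size_count (restriction M F) t = (if last t = s then F_num M 0 k t else 0)"
proof -
  have F: "flat M F" "rk M F = k" "card F = s" using u by (auto simp: flats_rank_size_def)
  have ne: "Xs \<noteq> []" if "Xs \<in> flat_chains M 0 k" for Xs
    using that by (auto simp: flat_chains_def)
  have "last Xs = F \<longleftrightarrow> last (map card Xs) = s" if X: "Xs \<in> flat_chains M 0 k" for Xs
  proof -
    have "flat M (last Xs)" "rk M (last Xs) = k"
      using flat_chain_nth[OF X, of k] flat_chain_last[OF X] by simp_all
    then have "card (last Xs) = s \<longleftrightarrow> last Xs \<in> flats_rank_size M k s"
      by (simp add: flats_rank_size_def)
    then show ?thesis using u ne[OF X] by (simp add: last_map)
  qed
  then have "{Xs \<in> flags (restriction M F). map card Xs = t} =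
      (if last t = s then {Xs \<in> flat_chains M 0 k. map card Xs = t} else {})"
    unfolding flags_restriction[OF F(1)] F(2) by auto
  then show ?thesis by (simp add: flag_size_count_def F_num_def)
qed

lemma rank_of_contraction:
  assumes "F \<subseteq> ground M"
  shows "rank_of (contraction M F) = rank_of M - rk M F"
proof -
  have "ground M - F \<union> F = ground M" using assms by blast
  then show ?thesis by (simp add: rank_of_def contraction_def)
qed

lemma flat_contraction_iff:
  assumes F: "F \<subseteq> ground M"
  shows "flat (contraction M F) X \<longleftrightarrow> X \<subseteq> ground M - F \<and> flat M (X \<union> F)"
proof (cases "X \<subseteq> ground M - F")
  case True
  have e: "ground M - F - X = ground M - (X \<union> F)" by blast
  have "rk M (X \<union> F) - rk M F < rk M (insert x (X \<union> F)) - rk M F \<longleftrightarrow>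
      rk M (X \<union> F) < rk M (insert x (X \<union> F))" if "x \<in> ground M - (X \<union> F)" for x
  proof -
    \<comment> \<open>Because of this bound, the truncated subtraction preserves strict
      inequality.\<close>
    have "rk M F \<le> rk M (X \<union> F)" using F True by (intro rk_mono) auto
    then show ?thesis by linarith
  qed
  then show ?thesis
    using True F unfolding flat_def contraction_def by (simp add: e) blast
next
  case False
  then show ?thesis by (simp add: flat_def contraction_def)
qed

text \<open>Adding \<open>F\<close> to every member turns a flag of \<open>M/F\<close> into a chain
  of flats of \<open>M\<close> that starts at \<open>F\<close>, and shifts all sizes by
  \<open>s\<close>. As \<open>F\<close> is unique, starting at \<open>F\<close> means having first
  size \<open>s\<close>, hence the condition \<open>hd t = 0\<close>.\<close>

lemma flag_size_count_contraction:
  assumes u: "flats_rank_size M k s = {F}"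
  shows "flag_size_count (contraction M F) t =
    (if t \<noteq> [] \<and> hd t = 0 then F_num M k (rank_of M) (map ((+) s) t) else 0)"
proof -
  let ?r = "rank_of M" and ?A = "{Xs \<in> flags (contraction M F). map card Xs = t}"
  have F: "flat M F" "rk M F = k" "card F = s" using u by (auto simp: flats_rank_size_def)
  have FE: "F \<subseteq> ground M" using F(1) by (simp add: flat_def)
  have fF: "finite F" using FE finite_ground by (rule finite_subset)
  have kr: "k \<le> ?r" using rk_mono[OF FE order_refl] F(2) by (simp add: rank_of_def)
  have rC: "rank_of (contraction M F) = ?r - k" using rank_of_contraction[OF FE] F(2) by simp
  have rkC: "rk (contraction M F) X = rk M (X \<union> F) - k" for X using F(2) by (simp add: contraction_def)
  have A: "length Xs = ?r - k + 1" "sorted_wrt (\<subset>) Xs"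
      "\<And>i. i < length Xs \<Longrightarrow> Xs ! i \<subseteq> ground M - F \<and> flat M (Xs ! i \<union> F) \<and> rk M (Xs ! i \<union> F) = k + i"
    if "Xs \<in> flags (contraction M F)" for Xs
  proof -
    show "length Xs = ?r - k + 1" "sorted_wrt (\<subset>) Xs"
      using that by (simp_all add: flags_def flat_chains_def rC)
    fix i assume "i < length Xs"
    then have i: "flat (contraction M F) (Xs ! i)" "rk M (Xs ! i \<union> F) - k = i"
      using that by (auto simp: flags_def flat_chains_def rkC)
    from i(1) have *: "Xs ! i \<subseteq> ground M - F" "flat M (Xs ! i \<union> F)"
      using flat_contraction_iff[OF FE] by auto
    have "k \<le> rk M (Xs ! i \<union> F)"
      using * F(2) by (subst F(2)[symmetric], intro rk_mono) (auto simp: flat_def)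
    then show "Xs ! i \<subseteq> ground M - F \<and> flat M (Xs ! i \<union> F) \<and> rk M (Xs ! i \<union> F) = k + i"
      using * i(2) by simp
  qed
  show ?thesis
  proof (cases "t \<noteq> [] \<and> hd t = 0")
    case False
    have "t \<noteq> [] \<and> hd t = 0" if X: "Xs \<in> flags (contraction M F)" "map card Xs = t" for Xs
    proof -
      have ne: "Xs \<noteq> []" using A(1)[OF X(1)] by auto
      have *: "Xs ! 0 \<subseteq> ground M - F" "flat M (Xs ! 0 \<union> F)" "rk M (Xs ! 0 \<union> F) = k"
        using A(3)[OF X(1), of 0] ne by auto
      \<comment> \<open>The first member joined with \<open>F\<close> is a flat of rank
        \<open>k\<close> containing \<open>F\<close>, so it is \<open>F\<close> itself and the first
        member is empty.\<close>
      have "F = Xs ! 0 \<union> F" using *(2,3) F by (intro flat_rank_eq) auto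
      then have "Xs ! 0 = {}" using *(1) by blast
      then show ?thesis using X(2) ne by (auto simp: hd_map hd_conv_nth)
    qed
    then have "?A = {}" using False by blast
    then show ?thesis using False by (simp only: flag_size_count_def card.empty if_False)
  next
    case True
    let ?B = "{Ys \<in> flat_chains M k ?r. map card Ys = map ((+) s) t}"
    have B: "F \<subseteq> Ys ! i" if Y: "Ys \<in> ?B" and i: "i \<le> ?r - k" for Ys i
    proof -
      have Y': "Ys \<in> flat_chains M k ?r" "map card Ys = map ((+) s) t" using Y by auto
      have ne: "Ys \<noteq> []" using Y'(1) by (auto simp: flat_chains_def)
      have "card (Ys ! 0) = s"
        using Y'(2) True ne by (metis add_0_right hd_conv_nth hd_map)
      then have "Ys ! 0 \<in> flats_rank_size M k s"
        using flat_chain_nth[OF Y'(1), of 0] by (simp add: flats_rank_size_def)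
      then have "Ys ! 0 = F" using u by simp
      then show ?thesis using flat_chain_mono[OF Y'(1) _ i, of 0] by simp
    qed
    have "bij_betw (map (\<lambda>X. X \<union> F)) ?A ?B"
    proof (rule bij_betw_byWitness[where f' = "map (\<lambda>Y. Y - F)"])
      show "\<forall>Xs \<in> ?A. map (\<lambda>Y. Y - F) (map (\<lambda>X. X \<union> F) Xs) = Xs"
      proof
        fix Xs assume "Xs \<in> ?A"
        then have X: "Xs \<in> flags (contraction M F)" by simp
        have "X \<union> F - F = X" if "X \<in> set Xs" for X
          using that A(3)[OF X] by (auto simp: in_set_conv_nth)
        then show "map (\<lambda>Y. Y - F) (map (\<lambda>X. X \<union> F) Xs) = Xs" by (simp add: map_idI)
      qed
      show "\<forall>Ys \<in> ?B. map (\<lambda>X. X \<union> F) (map (\<lambda>Y. Y - F) Ys) = Ys"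
      proof
        fix Ys assume Y: "Ys \<in> ?B"
        then have len: "length Ys = ?r - k + 1" by (simp add: flat_chains_def)
        have "Y - F \<union> F = Y" if Yin: "Y \<in> set Ys" for Y
        proof -
          obtain i where "i < length Ys" "Y = Ys ! i" using Yin by (auto simp: in_set_conv_nth)
          then show ?thesis using B[OF Y, of i] len by auto
        qed
        then show "map (\<lambda>X. X \<union> F) (map (\<lambda>Y. Y - F) Ys) = Ys" by (simp add: map_idI)
      qed
      show "map (\<lambda>X. X \<union> F) ` ?A \<subseteq> ?B"
      proof
        fix Zs assume "Zs \<in> map (\<lambda>X. X \<union> F) ` ?A"
        then obtain Xs where X: "Xs \<in> flags (contraction M F)" "map card Xs = t"
          and Z: "Zs = map (\<lambda>X. X \<union> F) Xs" by blast
        have "sorted_wrt (\<subset>) Zs"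
          unfolding sorted_wrt_iff_nth_less
        proof (intro allI impI)
          fix i j assume ij: "i < j" "j < length Zs"
          then have "Xs ! i \<subset> Xs ! j" "Xs ! j \<subseteq> ground M - F"
            using sorted_wrt_nth_less[OF A(2)[OF X(1)]] A(3)[OF X(1), of j] Z by auto
          then have "Xs ! i \<union> F \<subset> Xs ! j \<union> F" by blast
          then show "Zs ! i \<subset> Zs ! j" using ij Z by simp
        qed
        then have "Zs \<in> flat_chains M k ?r"
          using A[OF X(1)] Z by (simp add: flat_chains_def)
        moreover have "card (Xs ! i \<union> F) = s + card (Xs ! i)" if "i < length Xs" for i
        proof -
          have "finite (Xs ! i)" "Xs ! i \<inter> F = {}"
            using A(3)[OF X(1) that] finite_ground by (auto intro: finite_subset)
          then show ?thesis using F(3) fF by (simp add: card_Un_disjoint)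
        qed
        then have "map card Zs = map ((+) s) t"
          using X(2) Z by (auto simp: list_eq_iff_nth_eq)
        ultimately show "Zs \<in> ?B" by simp
      qed
      show "map (\<lambda>Y. Y - F) ` ?B \<subseteq> ?A"
      proof
        fix Zs assume "Zs \<in> map (\<lambda>Y. Y - F) ` ?B"
        then obtain Ys where Y: "Ys \<in> ?B" and Z: "Zs = map (\<lambda>Y. Y - F) Ys" by blast
        then have Y': "Ys \<in> flat_chains M k ?r" "map card Ys = map ((+) s) t" by auto
        have len: "length Ys = ?r - k + 1" using Y' by (simp add: flat_chains_def)
        have un: "Ys ! i - F \<union> F = Ys ! i" if "i < length Ys" for i
          using B[OF Y, of i] that len by auto
        have "flat (contraction M F) (Zs ! i) \<and> rk (contraction M F) (Zs ! i) = i"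
          if i: "i < length Ys" for i
        proof -
          have "flat M (Ys ! i)" "rk M (Ys ! i) = k + i"
            using flat_chain_nth[OF Y'(1), of i] i len by simp_all
          moreover have "Ys ! i - F \<subseteq> ground M - F"
            using flat_chain_subset_ground[OF Y'(1), of "Ys ! i"] i by auto
          ultimately show ?thesis
            using i Z un[OF i] by (simp add: flat_contraction_iff[OF FE] rkC)
        qed
        moreover have "sorted_wrt (\<subset>) Zs"
          unfolding sorted_wrt_iff_nth_less
        proof (intro allI impI)
          fix i j assume ij: "i < j" "j < length Zs"
          then have "Ys ! i \<subset> Ys ! j"
            using Y'(1) Z by (intro sorted_wrt_nth_less[of "(\<subset>)" Ys]) (auto simp: flat_chains_def)
          then have "Ys ! i - F \<subset> Ys ! j - F"
            using un[of i] un[of j] ij Z by auto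
          then show "Zs ! i \<subset> Zs ! j" using ij Z by simp
        qed
        ultimately have "Zs \<in> flat_chains (contraction M F) 0 (?r - k)"
          using len Z by (simp add: flat_chains_def)
        moreover have "last Zs = ground M - F"
        proof -
          have "flat M (last Ys)" "rk M (last Ys) = ?r"
            using flat_chain_nth[OF Y'(1), of "?r - k"] flat_chain_last[OF Y'(1)] kr by simp_all
          \<comment> \<open>A flat of full rank is the ground set, so every chain in
            \<open>?B\<close> ends there.\<close>
          then have "last Ys = ground M"
            using flat_ground by (intro flat_rank_eq) (auto simp: rank_of_def flat_def)
          moreover have "Ys \<noteq> []" using len by auto
          ultimately show ?thesis using Z by (simp add: last_map)
        qed
        ultimately have "Zs \<in> flags (contraction M F)"
          by (simp add: flags_def rC) (simp add: contraction_def)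
        moreover have "map card Zs = t"
        proof (rule nth_equalityI)
          show "length (map card Zs) = length t" using arg_cong[OF Y'(2), of length] Z by simp
          fix i assume "i < length (map card Zs)"
          then have i: "i < length Ys" using Z by simp
          have "card (Ys ! i) = s + t ! i"
            using arg_cong[OF Y'(2), of "\<lambda>l. l ! i"] arg_cong[OF Y'(2), of length] i by simp
          moreover have "card (Ys ! i - F) = card (Ys ! i) - s"
            using B[OF Y, of i] i len fF F(3) by (simp add: card_Diff_subset)
          ultimately show "map card Zs ! i = t ! i" using i Z by simp
        qed
        ultimately show "Zs \<in> ?A" by simp
      qed
    qed
    then have "card ?A = card ?B" by (rule bij_betw_same_card)
    then show ?thesis using True by (simp add: flag_size_count_def F_num_def)
  qed
qed

end

section \<open>Transfer of a unique flat and of its two minors\<close>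

lemma unique_flat_minors:
  fixes M :: "'a ranked_set" and M1 :: "'b ranked_set"
  assumes M: "matroid M" and M1: "matroid M1"
    and eq: "(G_inv M1 :: nat list \<Rightarrow>\<^sub>0 'k::field_char_0) = G_inv M"
    and u: "flats_rank_size M k s = {F}"
  shows "\<exists>F1. flats_rank_size M1 k s = {F1} \<and>
     (G_inv (restriction M1 F1) :: nat list \<Rightarrow>\<^sub>0 'k) = G_inv (restriction M F) \<and>
     (G_inv (contraction M1 F1) :: nat list \<Rightarrow>\<^sub>0 'k) = G_inv (contraction M F)"
proof -
  interpret M: matroid M by fact
  interpret M1: matroid M1 by fact
  have n: "card (ground M1) = card (ground M)" and r: "rank_of M1 = rank_of M"
    using G_inv_eq_size_rank[OF M M1 eq] by auto
  have flags: "flag_size_count M1 t = flag_size_count M t" for t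
    by (rule flag_size_count_eq_of_G_inv[OF M M1 eq])
  have F: "F \<subseteq> ground M" "rk M F = k" "card F = s"
    using u by (auto simp: flats_rank_size_def flat_def)
  have kr: "k \<le> rank_of M" using M.rk_mono[OF F(1) order_refl] F(2) by (simp add: rank_of_def)
  have F_num: "F_num M1 h l v = F_num M h l v" if "h \<le> l" "l \<le> rank_of M" for h l v
    by (rule F_num_eq[OF M M1 n r flags that])
  \<comment> \<open>One-member chains count flats, so the value 1 carries over and yields both
    existence and uniqueness of \<open>F1\<close>.\<close>
  have "f_num M1 k s = 1"
    using F_num[of k k "[s]"] kr u by (simp add: F_num_same_rank f_num_def)
  then obtain F1 where u1: "flats_rank_size M1 k s = {F1}"
    unfolding f_num_def by (rule card_1_singletonE)
  have F1: "F1 \<subseteq> ground M1" "rk M1 F1 = k" "card F1 = s"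
    using u1 by (auto simp: flats_rank_size_def flat_def)
  have "(G_inv (restriction M1 F1) :: nat list \<Rightarrow>\<^sub>0 'k) = G_inv (restriction M F)"
  proof (rule G_inv_eqI)
    show "matroid (restriction M F)" "matroid (restriction M1 F1)"
      using M.matroid_restriction M1.matroid_restriction F F1 by auto
    show "card (ground (restriction M1 F1)) = card (ground (restriction M F))"
      "rank_of (restriction M1 F1) = rank_of (restriction M F)"
      using F F1 by (simp_all add: restriction_def rank_of_def)
    show "flag_size_count (restriction M1 F1) t = flag_size_count (restriction M F) t" for t
      using F_num[of 0 k t] kr
      by (simp add: M.flag_size_count_restriction[OF u] M1.flag_size_count_restriction[OF u1])
  qed
  moreover have "(G_inv (contraction M1 F1) :: nat list \<Rightarrow>\<^sub>0 'k) = G_inv (contraction M F)"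
  proof (rule G_inv_eqI)
    show "matroid (contraction M F)" "matroid (contraction M1 F1)"
      using M.matroid_contraction M1.matroid_contraction F F1 by auto
    show "card (ground (contraction M1 F1)) = card (ground (contraction M F))"
      using F F1 n finite_subset[OF F(1) M.finite_ground] finite_subset[OF F1(1) M1.finite_ground]
      by (simp add: contraction_def card_Diff_subset)
    show "rank_of (contraction M1 F1) = rank_of (contraction M F)"
      using F F1 r M.rank_of_contraction M1.rank_of_contraction by simp
    show "flag_size_count (contraction M1 F1) t = flag_size_count (contraction M F) t" for t
      using F_num[of k "rank_of M"] kr r
      by (simp add: M.flag_size_count_contraction[OF u] M1.flag_size_count_contraction[OF u1])
  qed
  ultimately show ?thesis using u1 by blast
qed

theorem proposition5p2:
  fixes M :: "'a ranked_set" and n r :: nat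
  assumes "matroid M" and "card (ground M) = n" and "rank_of M = r"
  shows "(\<forall>h k s. h \<le> k \<and> k \<le> r \<and> length s = k - h + 1 \<longrightarrow>
           (\<forall>M1 :: 'b ranked_set. matroid M1 \<and> card (ground M1) = n \<and> rank_of M1 = r \<and>
              catenary_data M1 = catenary_data M \<longrightarrow> F_num M1 h k s = F_num M h k s)) \<and>
         (\<forall>k s. k \<le> r \<longrightarrow>
           (\<forall>M1 :: 'b ranked_set. matroid M1 \<and> card (ground M1) = n \<and> rank_of M1 = r \<and>
              catenary_data M1 = catenary_data M \<longrightarrow> f_num M1 k s = f_num M k s)) \<and>
         (\<forall>k s F. k \<le> r \<and> f_num M k s = 1 \<and> F \<in> flats_rank_size M k s \<longrightarrow>
           (\<forall>M1 :: 'b ranked_set. matroid M1 \<and>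
              (G_inv M1 :: nat list \<Rightarrow>\<^sub>0 'k::field_char_0) = G_inv M \<longrightarrow>
              (\<exists>F1. flats_rank_size M1 k s = {F1} \<and>
                 (G_inv (restriction M1 F1) :: nat list \<Rightarrow>\<^sub>0 'k) = G_inv (restriction M F) \<and>
                 (G_inv (contraction M1 F1) :: nat list \<Rightarrow>\<^sub>0 'k) = G_inv (contraction M F))))"
proof -
  have F_num: "F_num M1 h k s = F_num M h k s"
    if "h \<le> k" "k \<le> r" "matroid M1" "card (ground M1) = n" "rank_of M1 = r"
      "catenary_data M1 = catenary_data M" for h k s and M1 :: "'b ranked_set"
    using that assms
    by (intro F_num_eq flag_size_count_eq_of_catenary_data) simp_all
  show ?thesis
  proof (intro conjI allI impI; elim conjE)
    show "F_num M1 h k s = F_num M h k s"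
      if "h \<le> k" "k \<le> r" "matroid M1" "card (ground M1) = n" "rank_of M1 = r"
        "catenary_data M1 = catenary_data M" for h k s and M1 :: "'b ranked_set"
      using F_num that by blast
    show "f_num M1 k s = f_num M k s"
      if "k \<le> r" "matroid M1" "card (ground M1) = n" "rank_of M1 = r"
        "catenary_data M1 = catenary_data M" for k s and M1 :: "'b ranked_set"
      using F_num[of k k M1 "[s]"] that by (simp add: F_num_same_rank)
    show "\<exists>F1. flats_rank_size M1 k s = {F1} \<and>
         (G_inv (restriction M1 F1) :: nat list \<Rightarrow>\<^sub>0 'k) = G_inv (restriction M F) \<and>
         (G_inv (contraction M1 F1) :: nat list \<Rightarrow>\<^sub>0 'k) = G_inv (contraction M F)"
      if "f_num M k s = 1" "F \<in> flats_rank_size M k s" "matroid M1"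
        "(G_inv M1 :: nat list \<Rightarrow>\<^sub>0 'k) = G_inv M" for k s F and M1 :: "'b ranked_set"
    proof (rule unique_flat_minors[OF assms(1) that(3,4)])
      show "flats_rank_size M k s = {F}"
        using that(1,2) unfolding f_num_def by (metis card_1_singletonE singletonD)
    qed
  qed
qed

end
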